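(* If $\Gamma=\{r_z^1,\ldots,r_z^M\}$ is a finite set of resonance up-points corresponding to a non-real number $z$, then the operator $$\operatorname{Im}z\;Q_{\bar z}(\bar\Gamma)\,J\,P_z(\Gamma)$$ is non-negative and its rank is equal to the rank of $P_z(\Gamma)$.
   Context: Setting. $\mathcal H,\mathcal K$ are complex separable Hilbert spaces. $F:\mathcal H\to\mathcal K$ is a closed densely defined operator with trivial kernel and co-kernel. $H_0$ is a self-adjoint operator on $\mathcal H$, $V=F^*JF$ is a self-adjoint operator with $J$ bounded self-adjoint on $\mathcal K$, and $H_s=H_0+sV$, $s\in\mathbb R$. Standing assumptions: all $H_s$ are self-adjoint with a common dense domain $\mathcal D$, $\mathcal D\subset\operatorname{dom}(F)\cap\operatorname{dom}(V)$, $V$ is relatively compact with respect to each $H_s$, and for non-real $z$ the operator $T_z(H_s):=F(H_s-z)^{-1}F^*$ (densely defined on $\operatorname{dom}F^*$) extends to a compact operator on $\mathcal K$, also denoted $T_z(H_s)$. It is also assumed that for each $s$ the norm limit $\lim_{y\to0^+}T_{\lambda+iy}(H_s)$ exists for a.e. real $\lambda$. For non-real $z$ and real $s$ put $A_z(s)=T_z(H_s)J$ and $B_z(s)=JT_z(H_s)$. As functions of $s$ they extend meromorphically to $\mathbb C$. A complex number $r_z$ is a resonance point corresponding to $z$ if it is a pole of $s\mapsto A_z(s)$ (equivalently, $(s-r_z)^{-1}$ is an eigenvalue of $A_z(s)$ for a real $s$). It is an up-point if $\operatorname{Im}r_z>0$. If $r_z$ is a resonance point corresponding to $z$, then $\bar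 r_z$ is a resonance point corresponding to $\bar z$. The finite-rank idempotents $P_z(r_z)$, $Q_z(r_z)$ are $$P_z(r_z)=\frac1{2\pi i}\oint_{C}(\sigma-A_z(s))^{-1}d\sigma,\qquad Q_z(r_z)=\frac1{2\pi i}\oint_{C}(\sigma-B_z(s))^{-1}d\sigma,$$ where $C$ is a small circle enclosing only the eigenvalue $(s-r_z)^{-1}$ of $A_z(s)$; they do not depend on the real number $s$. For a finite set $\Gamma$ of resonance points corresponding to $z$: $P_z(\Gamma)=\sum_{r_z\in\Gamma}P_z(r_z)$, $Q_z(\Gamma)=\sum_{r_z\in\Gamma}Q_z(r_z)$, and $\bar\Gamma=\{\bar r_z:r_z\in\Gamma\}$. *)

theory Defs
  imports "HOL-Complex_Analysis.Complex_Analysis" "HOL-Library.Extended_Nat"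
begin

section \<open>Complex Hilbert spaces\<close>

text \<open>The inner product is conjugate-linear in its first argument.\<close>

class chilbert_space = banach +
  fixes scaleC :: "complex \<Rightarrow> 'a \<Rightarrow> 'a"  (infixr \<open>*\<^sub>C\<close> 75)
    and cinner :: "'a \<Rightarrow> 'a \<Rightarrow> complex"
  assumes scaleC_add_right: "c *\<^sub>C (x + y) = c *\<^sub>C x + c *\<^sub>C y"
    and scaleC_add_left: "(c + d) *\<^sub>C x = c *\<^sub>C x + d *\<^sub>C x"
    and scaleC_scaleC: "c *\<^sub>C d *\<^sub>C x = (c * d) *\<^sub>C x"
    and scaleR_scaleC: "r *\<^sub>R x = complex_of_real r *\<^sub>C x"
    and cinner_commute: "cinner x y = cnj (cinner y x)"
    and cinner_add_right: "cinner x (y + z) = cinner x y + cinner x z"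
    and cinner_scaleC_right: "cinner x (c *\<^sub>C y) = c * cinner x y"
    and cinner_self: "cinner x x = complex_of_real ((norm x)\<^sup>2)"

lemma scaleC_one: "1 *\<^sub>C x = (x :: 'a :: chilbert_space)"
  by (metis of_real_1 scaleR_one scaleR_scaleC)

global_interpretation cvec: vector_space "scaleC :: complex \<Rightarrow> 'a :: chilbert_space \<Rightarrow> 'a"
  by unfold_locales (simp_all add: scaleC_add_right scaleC_add_left scaleC_scaleC scaleC_one)

lemma norm_scaleC: "norm (c *\<^sub>C x) = cmod c * norm (x :: 'a :: chilbert_space)"
proof -
  have "complex_of_real ((norm (c *\<^sub>C x))\<^sup>2) = c * cnj (cinner x (c *\<^sub>C x))"
    by (metis cinner_self cinner_scaleC_right cinner_commute)
  also have "\<dots> = c * cnj c * complex_of_real ((norm x)\<^sup>2)"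
    by (simp add: cinner_scaleC_right cinner_self)
  also have "\<dots> = complex_of_real ((cmod c * norm x)\<^sup>2)"
    by (simp only: power_mult_distrib of_real_mult complex_norm_square)
  finally have "(norm (c *\<^sub>C x))\<^sup>2 = (cmod c * norm x)\<^sup>2"
    using of_real_eq_iff by blast
  then show ?thesis
    by (simp add: power2_eq_iff_nonneg)
qed

section \<open>Bounded operators\<close>

text \<open>
  Bounded operators are elements of \<^typ>\<open>'a \<Rightarrow>\<^sub>L 'a\<close>, whose topology is that of the operator norm.
  The elements of this type are only real-linear; complex linearity is imposed where needed.
  The operator \<open>cscale c\<close> is \<open>c\<close> times the identity, so that \<open>cscale c o\<^sub>L A\<close> is \<open>c\<close> times \<open>A\<close>.
\<close>

definition cscale :: "complex \<Rightarrow> 'a :: chilbert_space \<Rightarrow>\<^sub>L 'a" where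
  "cscale c = Blinfun (\<lambda>x. c *\<^sub>C x)"

lemma bounded_linear_scaleC: "bounded_linear (\<lambda>x :: 'a :: chilbert_space. c *\<^sub>C x)"
  by (rule bounded_linear_intro[where K = "cmod c"])
     (simp_all add: scaleC_add_right scaleR_scaleC scaleC_scaleC norm_scaleC mult.commute)

lemma cscale_apply [simp]: "blinfun_apply (cscale c) x = c *\<^sub>C x"
  by (simp add: cscale_def bounded_linear_Blinfun_apply bounded_linear_scaleC)

definition compact_operator :: "('a :: chilbert_space \<Rightarrow>\<^sub>L 'a) \<Rightarrow> bool" where
  "compact_operator T \<longleftrightarrow>
     (\<forall>c x. T (c *\<^sub>C x) = c *\<^sub>C T x) \<and> compact (closure (blinfun_apply T ` cball 0 1))"

definition nonneg_operator :: "('a :: chilbert_space \<Rightarrow>\<^sub>L 'a) \<Rightarrow> bool" where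
  "nonneg_operator T \<longleftrightarrow> (\<forall>x. cinner x (T x) \<in> \<real>\<^sub>\<ge>\<^sub>0)"

text \<open>The case distinction is needed because \<open>cvec.dim\<close> is 0 on infinite-dimensional spaces.\<close>

definition oprank :: "('a :: chilbert_space \<Rightarrow>\<^sub>L 'a) \<Rightarrow> enat" where
  "oprank T =
     (if \<exists>B. finite B \<and> cvec.span B = range (blinfun_apply T)
      then enat (cvec.dim (range (blinfun_apply T))) else \<infinity>)"

definition opinverse :: "('a :: chilbert_space \<Rightarrow>\<^sub>L 'a) \<Rightarrow> 'a \<Rightarrow>\<^sub>L 'a" where
  "opinverse A = (THE B. A o\<^sub>L B = id_blinfun \<and> B o\<^sub>L A = id_blinfun)"

text \<open>Operator-valued analogue of \<^const>\<open>has_contour_integral\<close>.\<close>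

definition has_op_contour_integral ::
    "(complex \<Rightarrow> 'a :: chilbert_space \<Rightarrow>\<^sub>L 'a) \<Rightarrow> ('a \<Rightarrow>\<^sub>L 'a) \<Rightarrow> (real \<Rightarrow> complex) \<Rightarrow> bool" where
  "has_op_contour_integral f I g \<longleftrightarrow>
     ((\<lambda>t. cscale (vector_derivative g (at t within {0..1})) o\<^sub>L f (g t)) has_integral I) {0..1}"

text \<open>
  The idempotent of \<open>A\<close> at an isolated point \<open>\<mu>\<close> of its spectrum: the common value of
  \<open>1 / (2 \<pi> i)\<close> times the integral of \<open>(\<sigma> - A)\<^sup>-\<^sup>1\<close> over all sufficiently small circles around \<open>\<mu>\<close>.
\<close>

definition riesz_idempotent :: "('a :: chilbert_space \<Rightarrow>\<^sub>L 'a) \<Rightarrow> complex \<Rightarrow> 'a \<Rightarrow>\<^sub>L 'a" where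
  "riesz_idempotent A \<mu> =
     (THE P. \<forall>\<^sub>F \<rho> in at_right 0.
        \<exists>I. has_op_contour_integral (\<lambda>\<sigma>. opinverse (cscale \<sigma> - A)) I (circlepath \<mu> \<rho>) \<and>
            P = cscale (1 / (2 * pi * \<i>)) o\<^sub>L I)"

definition op_holomorphic_on ::
    "(complex \<Rightarrow> 'a :: chilbert_space \<Rightarrow>\<^sub>L 'a) \<Rightarrow> complex set \<Rightarrow> bool" where
  "op_holomorphic_on g U \<longleftrightarrow>
     (\<forall>s\<in>U. \<exists>g'. (g has_derivative (\<lambda>h. cscale h o\<^sub>L g')) (at s within U))"

text \<open>Near every point \<open>a\<close>, \<open>G s = (s - a)\<^sup>-\<^sup>n g(s)\<close> for \<open>s \<noteq> a\<close>, with \<open>g\<close> holomorphic at \<open>a\<close>.\<close>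

definition op_meromorphic :: "(complex \<Rightarrow> 'a :: chilbert_space \<Rightarrow>\<^sub>L 'a) \<Rightarrow> bool" where
  "op_meromorphic G \<longleftrightarrow>
     (\<forall>a. \<exists>(n :: nat) g U. open U \<and> a \<in> U \<and> op_holomorphic_on g U \<and>
        (\<forall>s\<in>U - {a}. G s = cscale (1 / (s - a) ^ n) o\<^sub>L g s))"

section \<open>Unbounded operators\<close>

text \<open>
  An operator is represented by its graph.  Its domain and range are \<^const>\<open>Domain\<close> and
  \<^const>\<open>Range\<close>.  Beware that relational composition \<^term>\<open>S O T\<close> applies \<open>S\<close> first: it is the
  graph of the product \<open>T S\<close>.
\<close>

definition is_operator :: "('a :: chilbert_space \<times> 'b :: chilbert_space) set \<Rightarrow> bool" where
  "is_operator T \<longleftrightarrow>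
     (0, 0) \<in> T \<and>
     (\<forall>x u y v. (x, u) \<in> T \<longrightarrow> (y, v) \<in> T \<longrightarrow> (x + y, u + v) \<in> T) \<and>
     (\<forall>c x u. (x, u) \<in> T \<longrightarrow> (c *\<^sub>C x, c *\<^sub>C u) \<in> T) \<and>
     single_valued T"

definition op_graph :: "('a :: chilbert_space \<Rightarrow>\<^sub>L 'b :: chilbert_space) \<Rightarrow> ('a \<times> 'b) set" where
  "op_graph A = {(x, A x) | x. True}"

definition densely_defined :: "('a :: chilbert_space \<times> 'b :: chilbert_space) set \<Rightarrow> bool" where
  "densely_defined T \<longleftrightarrow> closure (Domain T) = UNIV"

definition op_adjoint :: "('a :: chilbert_space \<times> 'b :: chilbert_space) set \<Rightarrow> ('b \<times> 'a) set" where
  "op_adjoint T = {(y, w). \<forall>(x, v)\<in>T. cinner y v = cinner w x}"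

definition self_adjoint :: "('a :: chilbert_space \<times> 'a) set \<Rightarrow> bool" where
  "self_adjoint T \<longleftrightarrow> is_operator T \<and> densely_defined T \<and> op_adjoint T = T"

definition op_kernel :: "('a :: chilbert_space \<times> 'b :: chilbert_space) set \<Rightarrow> 'a set" where
  "op_kernel T = {x. (x, 0) \<in> T}"

text \<open>The co-kernel is the orthogonal complement of the range.\<close>

definition op_cokernel :: "('a :: chilbert_space \<times> 'b :: chilbert_space) set \<Rightarrow> 'b set" where
  "op_cokernel T = {y. \<forall>v\<in>Range T. cinner y v = 0}"

text \<open>\<open>H\<^sub>s = H\<^sub>0 + s V\<close>, on the intersection of the two domains.\<close>

definition pencil ::
    "('a :: chilbert_space \<times> 'a) set \<Rightarrow> ('a \<times> 'a) set \<Rightarrow> real \<Rightarrow> ('a \<times> 'a) set" where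
  "pencil H0 V s = {(x, u + s *\<^sub>R v) | x u v. (x, u) \<in> H0 \<and> (x, v) \<in> V}"

text \<open>\<open>(H - z)\<^sup>-\<^sup>1\<close>\<close>

definition resolvent :: "('a :: chilbert_space \<times> 'a) set \<Rightarrow> complex \<Rightarrow> ('a \<times> 'a) set" where
  "resolvent H z = {(u - z *\<^sub>C x, x) | x u. (x, u) \<in> H}"

text \<open>\<open>V\<close> is compact as a map from the domain of \<open>H\<close>, with the graph norm of \<open>H\<close>.\<close>

definition relatively_compact ::
    "('a :: chilbert_space \<times> 'a) set \<Rightarrow> ('a \<times> 'a) set \<Rightarrow> bool" where
  "relatively_compact V H \<longleftrightarrow>
     Domain H \<subseteq> Domain V \<and>
     compact (closure {v. \<exists>x u. (x, u) \<in> H \<and> (x, v) \<in> V \<and> norm x \<le> 1 \<and> norm u \<le> 1})"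

section \<open>Sandwiched resolvent and resonance points\<close>

text \<open>
  \<open>compact_extension F H z T\<close>: the compact operator \<open>T\<close> extends \<open>F (H - z)\<^sup>-\<^sup>1 F\<^sup>*\<close>.  There is at
  most one such \<open>T\<close> when the domain of \<open>F (H - z)\<^sup>-\<^sup>1 F\<^sup>*\<close> is dense.
\<close>

definition compact_extension ::
    "('h :: chilbert_space \<times> 'k :: chilbert_space) set \<Rightarrow> ('h \<times> 'h) set \<Rightarrow> complex \<Rightarrow>
     ('k \<Rightarrow>\<^sub>L 'k) \<Rightarrow> bool" where
  "compact_extension F H z T \<longleftrightarrow>
     compact_operator T \<and> op_adjoint F O resolvent H z O F \<subseteq> op_graph T"

definition T_op ::
    "('h :: chilbert_space \<times> 'k :: chilbert_space) set \<Rightarrow> ('h \<times> 'h) set \<Rightarrow> complex \<Rightarrow> 'k \<Rightarrow>\<^sub>L 'k" where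
  "T_op F H z = (THE T. compact_extension F H z T)"

text \<open>
  In the following definitions \<open>H :: real \<Rightarrow> _\<close> is the family \<open>s \<mapsto> H\<^sub>s\<close>.
\<close>

definition A_op ::
    "('h :: chilbert_space \<times> 'k :: chilbert_space) set \<Rightarrow> ('k \<Rightarrow>\<^sub>L 'k) \<Rightarrow> (real \<Rightarrow> ('h \<times> 'h) set) \<Rightarrow>
     complex \<Rightarrow> real \<Rightarrow> 'k \<Rightarrow>\<^sub>L 'k" where
  "A_op F J H z s = T_op F (H s) z o\<^sub>L J"

definition B_op ::
    "('h :: chilbert_space \<times> 'k :: chilbert_space) set \<Rightarrow> ('k \<Rightarrow>\<^sub>L 'k) \<Rightarrow> (real \<Rightarrow> ('h \<times> 'h) set) \<Rightarrow>
     complex \<Rightarrow> real \<Rightarrow> 'k \<Rightarrow>\<^sub>L 'k" where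
  "B_op F J H z s = J o\<^sub>L T_op F (H s) z"

text \<open>
  A resonance point is a pole of the meromorphic extension of \<open>s \<mapsto> A\<^sub>z(s)\<close>.  By the identity
  theorem the extension is unique up to its values on a discrete set, which do not affect
  \<^const>\<open>is_pole\<close>.
\<close>

definition resonance_point ::
    "('h :: chilbert_space \<times> 'k :: chilbert_space) set \<Rightarrow> ('k \<Rightarrow>\<^sub>L 'k) \<Rightarrow> (real \<Rightarrow> ('h \<times> 'h) set) \<Rightarrow>
     complex \<Rightarrow> complex \<Rightarrow> bool" where
  "resonance_point F J H z r \<longleftrightarrow>
     (\<exists>G. op_meromorphic G \<and> (\<forall>s :: real. G (of_real s) = A_op F J H z s) \<and> is_pole G r)"

text \<open>
  The idempotents do not depend on the real number \<open>s\<close> used to compute them; it is kept here as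
  the last argument.
\<close>

definition P_op ::
    "('h :: chilbert_space \<times> 'k :: chilbert_space) set \<Rightarrow> ('k \<Rightarrow>\<^sub>L 'k) \<Rightarrow> (real \<Rightarrow> ('h \<times> 'h) set) \<Rightarrow>
     complex \<Rightarrow> complex set \<Rightarrow> real \<Rightarrow> 'k \<Rightarrow>\<^sub>L 'k" where
  "P_op F J H z \<Gamma> s = (\<Sum>r\<in>\<Gamma>. riesz_idempotent (A_op F J H z s) (1 / (of_real s - r)))"

definition Q_op ::
    "('h :: chilbert_space \<times> 'k :: chilbert_space) set \<Rightarrow> ('k \<Rightarrow>\<^sub>L 'k) \<Rightarrow> (real \<Rightarrow> ('h \<times> 'h) set) \<Rightarrow>
     complex \<Rightarrow> complex set \<Rightarrow> real \<Rightarrow> 'k \<Rightarrow>\<^sub>L 'k" where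
  "Q_op F J H z \<Gamma> s = (\<Sum>r\<in>\<Gamma>. riesz_idempotent (B_op F J H z s) (1 / (of_real s - r)))"

end

theory Submission
  imports Defs
begin

text \<open>
  Write \<open>A = T\<^sub>z(H\<^sub>s) J\<close>.  Since \<open>T\<^sub>z\<close> and \<open>T\<close> at the conjugate of \<open>z\<close> are adjoint to each other, so
  are \<open>P\<close> and \<open>Q\<close>, and the operator in question is \<open>Im z P\<^sup>* J P\<close>.  It therefore suffices that
  \<open>Im z \<langle>v, J v\<rangle> > 0\<close> for every non-zero \<open>v\<close> in the range of \<open>P\<close>.  The eigenvalues \<open>1 / (s - r)\<close>
  belonging to up-points lie in the upper half-plane, so the orbit \<open>v(t) = exp (i t A) v\<close> decays as
  \<open>t\<close> grows.  Along it, \<open>Im z \<langle>v, J v\<rangle>\<close> has derivative \<open>- 2 Im z Im \<langle>J v, T\<^sub>z J v\<rangle>\<close>, which is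
  non-positive because \<open>Im \<langle>x, T\<^sub>z x\<rangle> = Im z \<parallel>(H\<^sub>s - z)\<^sup>-\<^sup>1 F\<^sup>* x\<parallel>\<^sup>2\<close>; hence the form is non-negative.
  If it vanishes at \<open>v\<close>, then \<open>A v(t) = 0\<close> throughout, so the orbit is constant, and \<open>v = 0\<close>.
\<close>

section \<open>Orthogonality in complex Hilbert spaces\<close>

text \<open>A computation on eigenvectors would not do: the eigenvalues \<open>1 / (s - r)\<close>
  need not be semisimple, so the range of \<open>P\<close> may contain Jordan chains, and different
  up-points give cross terms in the form. The exponential orbit deals with both at once, because
  only linearity of the equation and decay at infinity enter. The price is paid at strictness: the
  identity for the imaginary part is needed on the whole space and not only on the domain of the
  adjoint of \<open>F\<close>, with a vector \<open>h\<close> that still satisfies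
  \<open>F h = T x\<close>, so that \<open>h = 0\<close> forces \<open>T x = 0\<close>. The other
  obstacle is that \<open>riesz_idempotent\<close> and \<open>T_op\<close> are definite
  descriptions. For the former, non-zero points of the spectrum of a compact operator have to be
  isolated, whence the Riesz-Schauder theory; for the latter, the adjoint of \<open>F\<close> has to
  be densely defined. Operator-valued contour integrals are identified through the matrix elements
  \<open>cinner y (R \<sigma> x)\<close>, to which scalar residue calculus applies.\<close>

lemma cinner_add_left: "cinner (x + y) z = cinner x z + cinner y (z :: 'a :: chilbert_space)"
  by (metis cinner_commute cinner_add_right complex_cnj_add)

lemma cinner_scaleC_left: "cinner (c *\<^sub>C x) y = cnj c * cinner x (y :: 'a :: chilbert_space)"
  by (metis cinner_commute cinner_scaleC_right complex_cnj_mult)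

lemma cinner_scaleR_right: "cinner x (r *\<^sub>R y) = of_real r * cinner x (y :: 'a :: chilbert_space)"
  by (simp add: scaleR_scaleC cinner_scaleC_right)

lemma cinner_scaleR_left: "cinner (r *\<^sub>R x) y = of_real r * cinner x (y :: 'a :: chilbert_space)"
  by (simp add: scaleR_scaleC cinner_scaleC_left)

lemma cinner_zero_right [simp]: "cinner x (0 :: 'a :: chilbert_space) = 0"
  using cinner_add_right[of x 0 0] by simp

lemma cinner_zero_left [simp]: "cinner 0 (x :: 'a :: chilbert_space) = 0"
  using cinner_add_left[of 0 0 x] by simp

lemma cinner_minus_right: "cinner x (- y) = - cinner x (y :: 'a :: chilbert_space)"
  using cinner_add_right[of x y "- y"] by (simp add: eq_neg_iff_add_eq_0 add.commute)

lemma cinner_minus_left: "cinner (- x) y = - cinner x (y :: 'a :: chilbert_space)"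
  using cinner_add_left[of x "- x" y] by (simp add: eq_neg_iff_add_eq_0 add.commute)

lemma cinner_diff_right: "cinner x (y - z) = cinner x y - cinner x (z :: 'a :: chilbert_space)"
  using cinner_add_right[of x y "- z"] by (simp add: cinner_minus_right)

lemma cinner_diff_left: "cinner (x - y) z = cinner x z - cinner y (z :: 'a :: chilbert_space)"
  using cinner_add_left[of x "- y" z] by (simp add: cinner_minus_left)

lemmas cinner_simps =
  cinner_add_left cinner_add_right cinner_diff_left cinner_diff_right
  cinner_scaleC_left cinner_scaleC_right cinner_minus_left cinner_minus_right

lemma cinner_self_eq_0 [simp]: "cinner x x = 0 \<longleftrightarrow> x = (0 :: 'a :: chilbert_space)"
  by (simp add: cinner_self)

lemma cinner_left_cancel: "(\<And>x. cinner x y = cinner x z) \<Longrightarrow> y = (z :: 'a :: chilbert_space)"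
  by (metis cinner_diff_right cinner_self_eq_0 eq_iff_diff_eq_0)

lemma cinner_right_cancel: "(\<And>x. cinner y x = cinner z x) \<Longrightarrow> y = (z :: 'a :: chilbert_space)"
  by (metis cinner_diff_left cinner_self_eq_0 eq_iff_diff_eq_0)

lemma norm_add_sq:
  "(norm (x + y))\<^sup>2 = (norm x)\<^sup>2 + 2 * Re (cinner x y) + (norm (y :: 'a :: chilbert_space))\<^sup>2"
proof -
  have "complex_of_real ((norm (x + y))\<^sup>2)
      = of_real ((norm x)\<^sup>2) + (cinner x y + cnj (cinner x y)) + of_real ((norm y)\<^sup>2)"
    unfolding cinner_self[symmetric] cinner_add_left cinner_add_right
    using cinner_commute[of y x] by simp
  then have "complex_of_real ((norm (x + y))\<^sup>2)
      = of_real ((norm x)\<^sup>2 + 2 * Re (cinner x y) + (norm y)\<^sup>2)"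
    by (simp add: complex_add_cnj)
  then show ?thesis
    using of_real_eq_iff by blast
qed

lemma norm_diff_sq:
  "(norm (x - y))\<^sup>2 = (norm x)\<^sup>2 - 2 * Re (cinner x y) + (norm (y :: 'a :: chilbert_space))\<^sup>2"
  using norm_add_sq[of x "- y"] by (simp add: cinner_minus_right)

lemma norm_add_orthogonal:
  "cinner x y = 0 \<Longrightarrow> (norm (x + y))\<^sup>2 = (norm x)\<^sup>2 + (norm (y :: 'a :: chilbert_space))\<^sup>2"
  by (simp add: norm_add_sq)

text \<open>The remainder after removing from \<open>x\<close> its component along \<open>y\<close>.
  That it is non-negative is the Cauchy-Schwarz inequality; that it falls below the norm of
  \<open>x\<close> unless the component is 0 makes a nearest point an orthogonal projection.\<close>

lemma norm_diff_proj_sq: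
  fixes x y :: "'a :: chilbert_space"
  assumes "y \<noteq> 0"
  shows "(norm (x - (cinner y x / of_real ((norm y)\<^sup>2)) *\<^sub>C y))\<^sup>2
      = (norm x)\<^sup>2 - (cmod (cinner y x))\<^sup>2 / (norm y)\<^sup>2"
proof -
  define c where "c = cinner y x / of_real ((norm y)\<^sup>2)"
  have "Re (cinner x (c *\<^sub>C y)) = Re (cinner y x * cnj (cinner y x)) / (norm y)\<^sup>2"
    unfolding c_def cinner_scaleC_right using cinner_commute[of x y]
    by (metis (no_types) Re_divide_of_real times_divide_eq_left)
  also have "cinner y x * cnj (cinner y x) = of_real ((cmod (cinner y x))\<^sup>2)"
    by (simp only: complex_norm_square)
  finally have "Re (cinner x (c *\<^sub>C y)) = (cmod (cinner y x))\<^sup>2 / (norm y)\<^sup>2"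
    by simp
  moreover have "cmod (complex_of_real ((norm y)\<^sup>2)) = (norm y)\<^sup>2"
    by (simp del: of_real_power)
  then have "(norm (c *\<^sub>C y))\<^sup>2 = (cmod (cinner y x))\<^sup>2 / (norm y)\<^sup>2"
    using assms by (simp add: norm_scaleC c_def norm_divide field_simps power2_eq_square del: of_real_power)
  ultimately show ?thesis
    unfolding c_def[symmetric] norm_diff_sq by simp
qed

lemma cinner_Cauchy_Schwarz: "cmod (cinner x y) \<le> norm x * norm (y :: 'a :: chilbert_space)"
proof (cases "x = 0")
  case False
  have "0 \<le> (norm y)\<^sup>2 - (cmod (cinner x y))\<^sup>2 / (norm x)\<^sup>2"
    unfolding norm_diff_proj_sq[OF False, symmetric] by simp
  then have "(cmod (cinner x y))\<^sup>2 \<le> (norm x * norm y)\<^sup>2"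
    using False by (simp add: field_simps power_mult_distrib)
  then show ?thesis
    by (rule power2_le_imp_le) simp
qed simp

lemma bounded_bilinear_cinner:
  "bounded_bilinear (cinner :: 'a :: chilbert_space \<Rightarrow> 'a \<Rightarrow> complex)"
proof
  show "\<exists>K. \<forall>x y :: 'a. norm (cinner x y) \<le> norm x * norm y * K"
    by (intro exI[of _ 1]) (simp add: cinner_Cauchy_Schwarz)
qed (simp_all add: cinner_add_left cinner_add_right cinner_scaleR_left cinner_scaleR_right
       scaleR_conv_of_real)

lemmas continuous_on_cinner [continuous_intros] =
  bounded_bilinear.continuous_on[OF bounded_bilinear_cinner]
lemmas tendsto_cinner [tendsto_intros] =
  bounded_bilinear.tendsto[OF bounded_bilinear_cinner]

lemma bounded_bilinear_scaleC:
  "bounded_bilinear (scaleC :: complex \<Rightarrow> 'a :: chilbert_space \<Rightarrow> 'a)"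
proof
  show "\<exists>K. \<forall>a (b :: 'a). norm (a *\<^sub>C b) \<le> norm a * norm b * K"
    by (intro exI[of _ 1]) (simp add: norm_scaleC)
qed (simp_all add: scaleC_add_right scaleC_add_left scaleR_scaleC scaleC_scaleC
       scaleR_conv_of_real mult.commute)

lemmas continuous_on_scaleC [continuous_intros] =
  bounded_bilinear.continuous_on[OF bounded_bilinear_scaleC]
lemmas tendsto_scaleC [tendsto_intros] =
  bounded_bilinear.tendsto[OF bounded_bilinear_scaleC]

text \<open>Graphs of operators are sets of pairs; this structure lets projection and completeness
  arguments treat a graph as a closed subspace.\<close>

instantiation prod :: (chilbert_space, chilbert_space) chilbert_space
begin

definition scaleC_prod :: "complex \<Rightarrow> 'a \<times> 'b \<Rightarrow> 'a \<times> 'b" where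
  "scaleC_prod c p = (c *\<^sub>C fst p, c *\<^sub>C snd p)"

definition cinner_prod :: "'a \<times> 'b \<Rightarrow> 'a \<times> 'b \<Rightarrow> complex" where
  "cinner_prod p q = cinner (fst p) (fst q) + cinner (snd p) (snd q)"

instance
proof
  fix c d :: complex and r :: real and x y w :: "'a \<times> 'b"
  show "c *\<^sub>C (x + y) = c *\<^sub>C x + c *\<^sub>C y"
    by (simp add: scaleC_prod_def scaleC_add_right)
  show "(c + d) *\<^sub>C x = c *\<^sub>C x + d *\<^sub>C x"
    by (simp add: scaleC_prod_def scaleC_add_left)
  show "c *\<^sub>C d *\<^sub>C x = (c * d) *\<^sub>C x"
    by (simp add: scaleC_prod_def scaleC_scaleC)
  show "r *\<^sub>R x = complex_of_real r *\<^sub>C x"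
    by (simp add: scaleC_prod_def scaleR_prod_def scaleR_scaleC)
  show "cinner x y = cnj (cinner y x)"
    unfolding cinner_prod_def complex_cnj_add by (metis cinner_commute)
  show "cinner x (y + w) = cinner x y + cinner x w"
    by (simp add: cinner_prod_def cinner_add_right)
  show "cinner x (c *\<^sub>C y) = c * cinner x y"
    by (simp add: cinner_prod_def scaleC_prod_def cinner_scaleC_right algebra_simps)
  show "cinner x x = complex_of_real ((norm x)\<^sup>2)"
    by (simp add: cinner_prod_def norm_prod_def cinner_self)
qed

end

section \<open>Nearest points and orthogonal projections onto closed subspaces\<close>

lemma parallelogram:
  fixes x y :: "'a :: chilbert_space"
  shows "(norm (x - y))\<^sup>2 = 2 * (norm x)\<^sup>2 + 2 * (norm y)\<^sup>2 - (norm (x + y))\<^sup>2"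
  by (simp add: norm_add_sq norm_diff_sq)

lemma closest_point_in_subspace:
  fixes M :: "'a :: chilbert_space set"
  assumes M: "cvec.subspace M" "closed M"
  shows "\<exists>m\<in>M. \<forall>y\<in>M. norm (x - m) \<le> norm (x - y)"
proof -
  have "M \<noteq> {}"
    using cvec.subspace_0[OF M(1)] by auto
  define d where "d = infdist x M"
  have d0: "0 \<le> d"
    by (simp add: d_def infdist_nonneg)
  have dle: "d \<le> norm (x - y)" if "y \<in> M" for y
    using infdist_le[OF that, of x] by (simp add: d_def dist_norm)
  have "\<exists>m\<in>M. norm (x - m) < d + 1 / Suc n" for n
  proof -
    have "infdist x M < d + 1 / Suc n"
      by (simp add: d_def)
    then show ?thesis
      unfolding infdist_notempty[OF \<open>M \<noteq> {}\<close>]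
      by (subst (asm) cINF_less_iff) (auto simp: \<open>M \<noteq> {}\<close> dist_norm intro: bdd_belowI2[where m = 0])
  qed
  then obtain m where m: "\<And>n. m n \<in> M" "\<And>n. norm (x - m n) < d + 1 / Suc n"
    by metis
  have lim: "(\<lambda>n. norm (x - m n)) \<longlonglongrightarrow> d"
  proof (rule real_tendsto_sandwich)
    show "\<forall>\<^sub>F n in sequentially. d \<le> norm (x - m n)"
      using m dle by simp
    show "\<forall>\<^sub>F n in sequentially. norm (x - m n) \<le> d + 1 / Suc n"
      using less_imp_le[OF m(2)] by (intro always_eventually allI)
    show "(\<lambda>n. d + 1 / real (Suc n)) \<longlonglongrightarrow> d"
      using tendsto_add[OF tendsto_const[of d] LIMSEQ_inverse_real_of_nat]
      by (simp add: inverse_eq_divide)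
  qed simp
  \<comment> \<open>The midpoint of \<open>m k\<close> and \<open>m l\<close> lies in
    \<open>M\<close>, so its distance from \<open>x\<close> is at least \<open>d\<close>; the
    parallelogram law then makes the minimizing sequence Cauchy.\<close>
  have mid: "(norm (m k - m l))\<^sup>2 \<le> 2 * (norm (x - m k))\<^sup>2 + 2 * (norm (x - m l))\<^sup>2 - 4 * d\<^sup>2" for k l
  proof -
    have "(1/2) *\<^sub>C (m k + m l) \<in> M"
      by (intro cvec.subspace_scale cvec.subspace_add M m)
    then have "d \<le> norm (x - (1/2) *\<^sub>C (m k + m l))"
      by (rule dle)
    also have "x - (1/2) *\<^sub>C (m k + m l) = (1/2) *\<^sub>R ((x - m k) + (x - m l))"
      using scaleR_scaleC[of "1/2" "m k + m l"]
      by (simp add: algebra_simps flip: scaleR_2)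
    finally have "2 * d \<le> norm ((x - m k) + (x - m l))"
      by simp
    then have "4 * d\<^sup>2 \<le> (norm ((x - m k) + (x - m l)))\<^sup>2"
      using power_mono[of "2 * d" _ 2] d0 by (simp add: power_mult_distrib)
    then show ?thesis
      using parallelogram[of "x - m k" "x - m l"] by (simp add: norm_minus_commute)
  qed
  have "Cauchy m"
  proof (rule metric_CauchyI)
    fix e :: real assume "0 < e"
    have "(\<lambda>n. (norm (x - m n))\<^sup>2) \<longlonglongrightarrow> d\<^sup>2"
      by (intro tendsto_power lim)
    then have "\<forall>\<^sub>F n in sequentially. (norm (x - m n))\<^sup>2 < d\<^sup>2 + e\<^sup>2 / 4"
      by (rule order_tendstoD(2)) (use zero_less_power[OF \<open>0 < e\<close>, of 2] in linarith)
    then obtain N where N: "\<And>n. n \<ge> N \<Longrightarrow> (norm (x - m n))\<^sup>2 < d\<^sup>2 + e\<^sup>2 / 4"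
      by (auto simp: eventually_sequentially)
    have "dist (m k) (m l) < e" if "k \<ge> N" "l \<ge> N" for k l
    proof -
      have "(norm (m k - m l))\<^sup>2 < e\<^sup>2"
        using mid[of k l] N[OF that(1)] N[OF that(2)] by simp
      then show ?thesis
        unfolding dist_norm by (rule power2_less_imp_less) (use \<open>0 < e\<close> in simp)
    qed
    then show "\<exists>N. \<forall>k\<ge>N. \<forall>l\<ge>N. dist (m k) (m l) < e"
      by blast
  qed
  then obtain p where p: "m \<longlonglongrightarrow> p"
    by (auto simp: Cauchy_convergent_iff convergent_def)
  have "p \<in> M"
    using closed_sequentially[OF M(2) m(1) p] .
  moreover have "norm (x - p) = d"
    using LIMSEQ_unique[OF lim] p by (intro LIMSEQ_unique[OF _ lim] tendsto_intros)
  ultimately show ?thesis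
    using dle by auto
qed

lemma orthogonal_projection_exists:
  fixes M :: "'a :: chilbert_space set"
  assumes M: "cvec.subspace M" "closed M"
  obtains m where "m \<in> M" "\<And>y. y \<in> M \<Longrightarrow> cinner y (x - m) = 0"
proof -
  obtain m where m: "m \<in> M" "\<And>y. y \<in> M \<Longrightarrow> norm (x - m) \<le> norm (x - y)"
    using closest_point_in_subspace[OF M] by metis
  have "cinner y (x - m) = 0" if "y \<in> M" for y
  proof (cases "y = 0")
    case False
    \<comment> \<open>The optimal coefficient along \<open>y\<close>: moving from \<open>m\<close>
      to \<open>m + c y\<close> would come closer to \<open>x\<close> unless
      \<open>c = 0\<close>.\<close>
    define c where "c = cinner y (x - m) / of_real ((norm y)\<^sup>2)"
    have "m + c *\<^sub>C y \<in> M"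
      by (intro cvec.subspace_add cvec.subspace_scale M m that)
    from m(2)[OF this] have "(norm (x - m))\<^sup>2 \<le> (norm (x - m - c *\<^sub>C y))\<^sup>2"
      by (simp add: power_mono algebra_simps)
    then have "(cmod (cinner y (x - m)))\<^sup>2 / (norm y)\<^sup>2 \<le> 0"
      unfolding c_def norm_diff_proj_sq[OF False] by simp
    then show ?thesis
      using False by (simp add: divide_le_0_iff)
  qed simp
  with m(1) show ?thesis
    using that by blast
qed

text \<open>Riesz's lemma in its sharp Hilbert space form: \<open>e\<close> has distance exactly 1
  from \<open>M\<close>. It supplies the separated sequences in both spectral arguments on compact
  operators.\<close>

lemma unit_vector_orthogonal:
  fixes M N :: "'a :: chilbert_space set"
  assumes M: "cvec.subspace M" "closed M" and N: "cvec.subspace N" "M \<subset> N"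
  obtains e where "e \<in> N" "norm e = 1" "\<And>y. y \<in> M \<Longrightarrow> cinner y e = 0"
proof -
  obtain x where x: "x \<in> N" "x \<notin> M"
    using N(2) by auto
  obtain m where m: "m \<in> M" "\<And>y. y \<in> M \<Longrightarrow> cinner y (x - m) = 0"
    using orthogonal_projection_exists[OF M] by metis
  have "x \<noteq> m"
    using x m by auto
  show ?thesis
  proof
    show "(1 / norm (x - m)) *\<^sub>C (x - m) \<in> N"
      by (intro cvec.subspace_scale cvec.subspace_diff N(1) x) (use m N in auto)
    show "norm ((1 / norm (x - m)) *\<^sub>C (x - m)) = 1"
      using \<open>x \<noteq> m\<close> by (simp add: norm_scaleC norm_divide)
  qed (simp add: m cinner_scaleC_right)
qed

lemma subspace_eq_UNIV:
  fixes M :: "'a :: chilbert_space set"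
  assumes "cvec.subspace M" "closed M" and "\<And>e. (\<And>y. y \<in> M \<Longrightarrow> cinner y e = 0) \<Longrightarrow> e = 0"
  shows "M = UNIV"
proof (rule ccontr)
  assume "M \<noteq> UNIV"
  then have "M \<subset> UNIV"
    by auto
  from unit_vector_orthogonal[OF assms(1,2) cvec.subspace_UNIV this] assms(3) show False
    by (metis norm_zero zero_neq_one)
qed

lemma norm_le_norm_add_orthogonal:
  fixes e :: "'a :: chilbert_space"
  assumes "cinner y e = 0"
  shows "norm e \<le> norm (e + y)"
proof -
  have "cinner e y = 0"
    using assms cinner_commute[of e y] by simp
  then have "(norm e)\<^sup>2 \<le> (norm (e + y))\<^sup>2"
    by (simp add: norm_add_orthogonal)
  then show ?thesis
    by (rule power2_le_imp_le) simp
qed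

section \<open>Spectra of compact operators\<close>

lemma norm_cscale_le: "norm (cscale c :: 'a :: chilbert_space \<Rightarrow>\<^sub>L 'a) \<le> cmod c"
  by (rule norm_blinfun_bound) (simp_all add: norm_scaleC)

definition clinear_op :: "('a :: chilbert_space \<Rightarrow>\<^sub>L 'b :: chilbert_space) \<Rightarrow> bool" where
  "clinear_op A \<longleftrightarrow> (\<forall>c x. A (c *\<^sub>C x) = c *\<^sub>C A x)"

lemma clinear_opD: "clinear_op A \<Longrightarrow> A (c *\<^sub>C x) = c *\<^sub>C A x"
  by (simp add: clinear_op_def)

lemma compact_operator_clinear: "compact_operator A \<Longrightarrow> clinear_op A"
  by (simp add: compact_operator_def clinear_op_def)

lemma clinear_op_shift: "clinear_op A \<Longrightarrow> clinear_op (cscale \<sigma> - A)"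
  by (simp add: clinear_op_def blinfun.diff_left scaleC_scaleC mult.commute
      cvec.scale_right_diff_distrib)

section \<open>Compact operators: stability under composition, and convergent subsequences of
  images\<close>

lemma compact_closure_subset:
  fixes S K :: "'a :: metric_space set"
  assumes "compact K" "S \<subseteq> K"
  shows "compact (closure S)"
proof -
  have "closure S \<subseteq> K"
    using assms by (intro closure_minimal compact_imp_closed)
  then have "closure S = K \<inter> closure S"
    by blast
  then show ?thesis
    using compact_Int_closed[OF assms(1) closed_closure[of S]] by simp
qed

lemma compact_operator_comp_right:
  fixes T J :: "'a :: chilbert_space \<Rightarrow>\<^sub>L 'a"
  assumes T: "compact_operator T" and J: "clinear_op J"
  shows "compact_operator (T o\<^sub>L J)"
proof -
  \<comment> \<open>The summand 1 keeps \<open>K\<close> positive when \<open>J = 0\<close>;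
    dividing \<open>J\<close> by \<open>K\<close> maps the unit ball into itself.\<close>
  define K where "K = norm J + 1"
  have "K > 0"
    by (simp add: K_def add_nonneg_pos)
  have "compact ((\<lambda>x. K *\<^sub>R x) ` closure (T ` cball 0 1))"
    using T by (intro compact_continuous_image continuous_intros) (auto simp: compact_operator_def)
  moreover have "(T o\<^sub>L J) ` cball 0 1 \<subseteq> (\<lambda>x. K *\<^sub>R x) ` closure (T ` cball 0 1)"
  proof safe
    fix x :: 'a assume "x \<in> cball 0 1"
    then have "norm (J x) \<le> norm J * 1"
      by (intro order_trans[OF norm_blinfun] mult_left_mono) simp_all
    then have "J x /\<^sub>R K \<in> cball 0 1"
      using \<open>K > 0\<close> by (simp add: K_def field_simps)
    then have "T (J x /\<^sub>R K) \<in> closure (T ` cball 0 1)"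
      by (intro closure_subset[THEN subsetD] imageI)
    moreover have "(T o\<^sub>L J) x = K *\<^sub>R T (J x /\<^sub>R K)"
      using \<open>K > 0\<close> by (simp add: blinfun.scaleR_right)
    ultimately show "(T o\<^sub>L J) x \<in> (\<lambda>x. K *\<^sub>R x) ` closure (T ` cball 0 1)"
      by blast
  qed
  ultimately show ?thesis
    using T J by (auto simp: compact_operator_def clinear_op_def intro: compact_closure_subset)
qed

lemma compact_operator_comp_left:
  fixes T J :: "'a :: chilbert_space \<Rightarrow>\<^sub>L 'a"
  assumes T: "compact_operator T" and J: "clinear_op J"
  shows "compact_operator (J o\<^sub>L T)"
proof -
  have "compact (J ` closure (T ` cball 0 1))"
    using T by (intro compact_continuous_image continuous_intros) (auto simp: compact_operator_def)
  moreover have "(J o\<^sub>L T) ` cball 0 1 \<subseteq> J ` closure (T ` cball 0 1)"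
    using closure_subset[of "T ` cball 0 1"] by auto
  ultimately show ?thesis
    using T J by (auto simp: compact_operator_def clinear_op_def intro: compact_closure_subset)
qed

lemma compact_operator_subseq:
  fixes A :: "'a :: chilbert_space \<Rightarrow>\<^sub>L 'a" and x :: "nat \<Rightarrow> 'a"
  assumes "compact_operator A" "\<And>n. norm (x n) = 1"
  obtains r l where "strict_mono r" "(\<lambda>n. A (x (r n))) \<longlonglongrightarrow> l"
proof -
  have "seq_compact (closure (A ` cball 0 1))"
    using assms by (simp add: compact_operator_def compact_eq_seq_compact_metric)
  moreover have "\<forall>n. A (x n) \<in> closure (A ` cball 0 1)"
    using assms by (intro allI closure_subset[THEN subsetD] imageI) simp
  ultimately obtain l and r :: "nat \<Rightarrow> nat" where "strict_mono r" "((\<lambda>n. A (x n)) \<circ> r) \<longlonglongrightarrow> l"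
    using seq_compactE by metis
  then show ?thesis
    using that[of r l] by (simp add: o_def)
qed

text \<open>Compactness would extract a Cauchy subsequence of the images. The negations of the
  Fredholm alternative and of the finiteness of eigenvalues are both brought into this form.\<close>

lemma compact_operator_not_separated:
  fixes A :: "'a :: chilbert_space \<Rightarrow>\<^sub>L 'a" and e :: "nat \<Rightarrow> 'a"
  assumes "compact_operator A" "\<And>n. norm (e n) = 1"
    and "\<delta> > 0" "\<And>m n. m < n \<Longrightarrow> \<delta> \<le> norm (A (e m) - A (e n))"
  shows False
proof -
  obtain r l where r: "strict_mono r" and "(\<lambda>n. A (e (r n))) \<longlonglongrightarrow> l"
    using compact_operator_subseq[OF assms(1,2)] .
  then have "Cauchy (\<lambda>n. A (e (r n)))"
    by (auto simp: Cauchy_convergent_iff convergent_def)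
  then obtain N where "\<And>m n. m \<ge> N \<Longrightarrow> n \<ge> N \<Longrightarrow> dist (A (e (r m))) (A (e (r n))) < \<delta>"
    using \<open>\<delta> > 0\<close> unfolding Cauchy_def by meson
  then have "dist (A (e (r N))) (A (e (r (Suc N)))) < \<delta>"
    by simp
  with assms(4)[of "r N" "r (Suc N)"] r show False
    by (simp add: dist_norm strict_mono_less)
qed

text \<open>Otherwise there are unit vectors \<open>y n\<close> for which
  \<open>\<mu> y - A y\<close> tends to 0. Along a subsequence \<open>A y\<close> converges, hence
  so does \<open>\<mu> y\<close>, and the limit is a non-zero eigenvector.\<close>

lemma compact_operator_shift_bounded_below:
  fixes A :: "'a :: chilbert_space \<Rightarrow>\<^sub>L 'a"
  assumes A: "compact_operator A" and "\<mu> \<noteq> 0" and inj: "\<And>x. A x = \<mu> *\<^sub>C x \<Longrightarrow> x = 0"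
  shows "\<exists>c>0. \<forall>x. c * norm x \<le> norm (\<mu> *\<^sub>C x - A x)"
proof (rule ccontr)
  assume "\<not> ?thesis"
  then have "\<exists>x. norm (\<mu> *\<^sub>C x - A x) < 1 / real (Suc n) * norm x" for n :: nat
    by (metis not_le of_nat_0_less_iff zero_less_Suc zero_less_divide_1_iff)
  then obtain x where x: "\<And>n. norm (\<mu> *\<^sub>C x n - A (x n)) < 1 / real (Suc n) * norm (x n)"
    by metis
  have x0: "norm (x n) > 0" for n
    using x[of n] by (cases "x n = 0") auto
  define y where "y n = x n /\<^sub>R norm (x n)" for n
  have y1: "norm (y n) = 1" for n
    using x0[of n] by (simp add: y_def)
  have "norm (\<mu> *\<^sub>C y n - A (y n)) < 1 / real (Suc n)" for n
  proof -
    have "\<mu> *\<^sub>C y n - A (y n) = (\<mu> *\<^sub>C x n - A (x n)) /\<^sub>R norm (x n)"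
      unfolding y_def blinfun.scaleR_right scaleR_scaleC
      by (simp add: cvec.scale_right_diff_distrib scaleC_scaleC mult.commute
          clinear_opD[OF compact_operator_clinear[OF A]])
    then have "norm (\<mu> *\<^sub>C y n - A (y n)) = norm (\<mu> *\<^sub>C x n - A (x n)) / norm (x n)"
      by (simp add: divide_inverse mult.commute)
    then show ?thesis
      using x[of n] x0[of n] by (simp only: pos_divide_less_eq)
  qed
  then have "(\<lambda>n. \<mu> *\<^sub>C y n - A (y n)) \<longlonglongrightarrow> 0"
    by (intro LIMSEQ_norm_0)
  moreover obtain r l where r: "strict_mono r" and l: "(\<lambda>n. A (y (r n))) \<longlonglongrightarrow> l"
    using compact_operator_subseq[OF A y1] .
  ultimately have "(\<lambda>n. (\<mu> *\<^sub>C y (r n) - A (y (r n))) + A (y (r n))) \<longlonglongrightarrow> 0 + l"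
    by (intro tendsto_add l) (auto dest: LIMSEQ_subseq_LIMSEQ simp: o_def)
  then have \<mu>y: "(\<lambda>n. \<mu> *\<^sub>C y (r n)) \<longlonglongrightarrow> l"
    by simp
  then have "(\<lambda>n. norm (\<mu> *\<^sub>C y (r n))) \<longlonglongrightarrow> norm l"
    by (rule tendsto_norm)
  then have "norm l = cmod \<mu>"
    by (simp add: norm_scaleC y1 LIMSEQ_const_iff)
  have "(\<lambda>n. A (\<mu> *\<^sub>C y (r n))) \<longlonglongrightarrow> A l"
    by (intro tendsto_intros \<mu>y)
  moreover have "(\<lambda>n. A (\<mu> *\<^sub>C y (r n))) \<longlonglongrightarrow> \<mu> *\<^sub>C l"
    unfolding clinear_opD[OF compact_operator_clinear[OF A]] by (intro tendsto_intros l)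
  ultimately have "A l = \<mu> *\<^sub>C l"
    by (rule LIMSEQ_unique)
  with inj \<open>norm l = cmod \<mu>\<close> \<open>\<mu> \<noteq> 0\<close> show False
    by fastforce
qed

lemma real_subspace_if_complex: "cvec.subspace M \<Longrightarrow> subspace (M :: 'a :: chilbert_space set)"
  by (simp add: subspace_def cvec.subspace_def scaleR_scaleC)

lemma cvec_subspace_image:
  assumes "clinear_op f" "cvec.subspace M"
  shows "cvec.subspace (f ` M)"
  unfolding cvec.subspace_def
proof (intro conjI allI ballI)
  show "0 \<in> f ` M"
    using assms(2) by (auto simp: cvec.subspace_0 intro!: image_eqI[of _ _ 0] simp flip: blinfun.zero_right)
next
  fix x y assume "x \<in> f ` M" "y \<in> f ` M"
  then show "x + y \<in> f ` M"
    using cvec.subspace_add[OF assms(2)] by (auto simp flip: blinfun.add_right)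
next
  fix c x assume "x \<in> f ` M"
  then show "c *\<^sub>C x \<in> f ` M"
    using cvec.subspace_scale[OF assms(2)] by (auto simp: clinear_opD[OF assms(1), symmetric])
qed

text \<open>A linear map that is bounded below reflects Cauchy sequences, so images of complete
  subspaces are complete.\<close>

lemma closed_image_if_bounded_below:
  fixes f :: "'a :: chilbert_space \<Rightarrow>\<^sub>L 'b :: chilbert_space"
  assumes "c > 0" "\<And>x. c * norm x \<le> norm (f x)" "cvec.subspace M" "closed M"
  shows "closed (f ` M)"
  using complete_isometric_image[of c M f] assms
  by (auto simp: real_subspace_if_complex blinfun.bounded_linear_right complete_eq_closed)

text \<open>
  Otherwise the ranges of the powers of \<open>\<mu> - A\<close> decrease strictly, and unit vectors in the
  successive orthogonal complements have images under \<open>A\<close> at mutual distance at least \<open>\<bar>\<mu>\<bar>\<close>.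
\<close>

lemma compact_operator_Fredholm_alternative:
  fixes A :: "'a :: chilbert_space \<Rightarrow>\<^sub>L 'a"
  assumes A: "compact_operator A" and "\<mu> \<noteq> 0" and inj: "\<And>x. A x = \<mu> *\<^sub>C x \<Longrightarrow> x = 0"
  shows "surj (cscale \<mu> - A)"
proof (rule ccontr)
  define f where "f = cscale \<mu> - A"
  have f_apply: "f x = \<mu> *\<^sub>C x - A x" for x
    by (simp add: f_def blinfun.diff_left)
  have clin: "clinear_op f"
    unfolding f_def by (intro clinear_op_shift compact_operator_clinear A)
  obtain c where c: "c > 0" "\<And>x. c * norm x \<le> norm (f x)"
    using compact_operator_shift_bounded_below[OF assms] unfolding f_apply by blast
  have inj_f: "inj f"
  proof (rule injI)
    fix x y assume "f x = f y"
    then have "f (x - y) = 0"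
      by (simp add: blinfun.diff_right)
    with c(2)[of "x - y"] c(1) show "x = y"
      by (simp add: mult_le_0_iff)
  qed
  assume "\<not> surj (cscale \<mu> - A)"
  then have "range f \<subset> UNIV"
    by (auto simp: f_def)
  define R where "R n = (blinfun_apply f ^^ n) ` UNIV" for n
  have R_Suc: "R (Suc n) = f ` R n" for n
    by (simp add: R_def image_comp)
  have R: "cvec.subspace (R n) \<and> closed (R n) \<and> R (Suc n) \<subset> R n" for n
  proof (induction n)
    case 0
    then show ?case
      using \<open>range f \<subset> UNIV\<close> by (simp add: R_def)
  next
    case (Suc n)
    then show ?case
      unfolding R_Suc[of n]
      using R_Suc[of "Suc n"] c
      by (intro conjI cvec_subspace_image closed_image_if_bounded_below[of c] clin)
         (auto dest: inj_image_subset_iff[OF inj_f, THEN iffD1]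
            simp: R_Suc[of n] psubset_eq inj_image_eq_iff[OF inj_f] image_mono)
  qed
  have R_Suc_sub: "R (Suc n) \<subseteq> R n" for n
    using R by blast
  have R_antimono: "R n \<subseteq> R m" if "m \<le> n" for m n
    by (rule lift_Suc_antimono_le[of R, OF R_Suc_sub that])
  have "\<exists>e. e \<in> R n \<and> norm e = 1 \<and> (\<forall>y\<in>R (Suc n). cinner y e = 0)" for n
    using unit_vector_orthogonal[of "R (Suc n)" "R n"] R by metis
  then obtain e where e: "\<And>n. e n \<in> R n" "\<And>n. norm (e n) = 1"
      "\<And>n y. y \<in> R (Suc n) \<Longrightarrow> cinner y (e n) = 0"
    by metis
  have "cmod \<mu> \<le> norm (A (e m) - A (e n))" if "m < n" for m n
  proof -
    have mem: "e n \<in> R (Suc m)" "f (e n) \<in> R (Suc m)" "f (e m) \<in> R (Suc m)"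
      using e(1)[of m] e(1)[of n] R_antimono[of "Suc m" n] R_antimono[of m n] that
      by (auto simp: R_Suc)
    \<comment> \<open>\<open>A e_m - A e_n = \<mu> e_m + (f e_n - f e_m - \<mu> e_n)\<close>, and
      the bracket lies in \<open>R (Suc m)\<close>, to which \<open>e m\<close> is
      orthogonal.\<close>
    have "f (e n) - f (e m) - \<mu> *\<^sub>C e n \<in> R (Suc m)"
      by (intro cvec.subspace_diff cvec.subspace_scale mem) (use R in auto)
    then have "norm (\<mu> *\<^sub>C e m) \<le> norm (\<mu> *\<^sub>C e m + (f (e n) - f (e m) - \<mu> *\<^sub>C e n))"
      by (intro norm_le_norm_add_orthogonal) (simp add: cinner_scaleC_right e(3))
    then show ?thesis
      by (simp add: f_apply norm_scaleC e(2))
  qed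
  then show False
    by (intro compact_operator_not_separated[OF A e(2), of "cmod \<mu>"]) (use \<open>\<mu> \<noteq> 0\<close> in simp)
qed

section \<open>Invertibility of shifts and isolation of the non-zero spectrum\<close>

definition op_invertible :: "('a :: chilbert_space \<Rightarrow>\<^sub>L 'a) \<Rightarrow> bool" where
  "op_invertible A \<longleftrightarrow> (\<exists>B. A o\<^sub>L B = id_blinfun \<and> B o\<^sub>L A = id_blinfun)"

lemma op_invertible_opinverse:
  assumes "op_invertible A"
  shows "A o\<^sub>L opinverse A = id_blinfun" "opinverse A o\<^sub>L A = id_blinfun"
proof -
  have "\<exists>!B. A o\<^sub>L B = id_blinfun \<and> B o\<^sub>L A = id_blinfun"
  proof (rule ex_ex1I)
    fix B C
    assume B: "A o\<^sub>L B = id_blinfun \<and> B o\<^sub>L A = id_blinfun"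
      and C: "A o\<^sub>L C = id_blinfun \<and> C o\<^sub>L A = id_blinfun"
    have "B = B o\<^sub>L (A o\<^sub>L C)"
      using C by (simp add: blinfun_eqI)
    also have "\<dots> = (B o\<^sub>L A) o\<^sub>L C"
      by (simp add: blinfun_eqI)
    finally show "B = C"
      using B by (simp add: blinfun_eqI)
  qed (use assms in \<open>simp add: op_invertible_def\<close>)
  from theI'[OF this] show "A o\<^sub>L opinverse A = id_blinfun" "opinverse A o\<^sub>L A = id_blinfun"
    by (simp_all add: opinverse_def)
qed

lemma opinverse_right: "op_invertible A \<Longrightarrow> A (opinverse A x) = x"
  using op_invertible_opinverse(1)[of A] by (metis blinfun_apply_blinfun_compose id_blinfun.rep_eq)

lemma opinverse_left: "op_invertible A \<Longrightarrow> opinverse A (A x) = x"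
  using op_invertible_opinverse(2)[of A] by (metis blinfun_apply_blinfun_compose id_blinfun.rep_eq)

text \<open>Surjectivity is the Fredholm alternative; the lower bound \<open>c\<close> gives
  injectivity and bounds the inverse by \<open>1 / c\<close>.\<close>

lemma compact_operator_shift_invertible:
  fixes A :: "'a :: chilbert_space \<Rightarrow>\<^sub>L 'a"
  assumes A: "compact_operator A" and "\<mu> \<noteq> 0" and inj: "\<And>x. A x = \<mu> *\<^sub>C x \<Longrightarrow> x = 0"
  shows "op_invertible (cscale \<mu> - A)"
proof -
  define f where "f = cscale \<mu> - A"
  have f_apply: "f x = \<mu> *\<^sub>C x - A x" for x
    by (simp add: f_def blinfun.diff_left)
  obtain c where c: "c > 0" "\<And>x. c * norm x \<le> norm (f x)"
    using compact_operator_shift_bounded_below[OF assms] unfolding f_apply by blast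
  have "surj f"
    unfolding f_def by (rule compact_operator_Fredholm_alternative[OF assms])
  then obtain g where fg: "\<And>x. f (g x) = x"
    by (metis surjD)
  have inj_f: "x = y" if "f x = f y" for x y
  proof -
    have "f (x - y) = 0"
      using that by (simp add: blinfun.diff_right)
    with c(2)[of "x - y"] c(1) show ?thesis
      by (simp add: mult_le_0_iff)
  qed
  have g: "bounded_linear g"
  proof (rule bounded_linear_intro[where K = "1 / c"])
    fix x y r
    show "g (x + y) = g x + g y"
      by (rule inj_f) (simp add: fg blinfun.add_right)
    show "g (r *\<^sub>R x) = r *\<^sub>R g x"
      by (rule inj_f) (simp add: fg blinfun.scaleR_right)
    show "norm (g x) \<le> norm x * (1 / c)"
      using c(2)[of "g x"] c(1) by (simp add: fg field_simps)
  qed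
  have "f o\<^sub>L Blinfun g = id_blinfun"
    by (rule blinfun_eqI) (simp add: bounded_linear_Blinfun_apply[OF g] fg)
  moreover have "Blinfun g o\<^sub>L f = id_blinfun"
    by (rule blinfun_eqI) (simp add: bounded_linear_Blinfun_apply[OF g] fg inj_f[OF fg])
  ultimately show ?thesis
    unfolding op_invertible_def f_def by blast
qed

text \<open>Infinitely many eigenvalues would give a strictly increasing chain of closed invariant
  subspaces \<open>M n\<close>, with \<open>\<sigma> n - A\<close> mapping \<open>M (Suc n)\<close>
  into \<open>M n\<close>. Unit vectors orthogonal to the preceding subspace then have images at
  least \<delta> apart.\<close>

lemma compact_operator_finite_eigenvalues:
  fixes A :: "'a :: chilbert_space \<Rightarrow>\<^sub>L 'a"
  assumes A: "compact_operator A" and "\<delta> > 0"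
  shows "finite {\<sigma>. \<delta> \<le> cmod \<sigma> \<and> (\<exists>x. x \<noteq> 0 \<and> A x = \<sigma> *\<^sub>C x)}" (is "finite ?E")
proof (rule ccontr)
  note A_scale = clinear_opD[OF compact_operator_clinear[OF A]]
  assume "infinite ?E"
  from infinite_countable_subset[OF this]
  obtain \<sigma> :: "nat \<Rightarrow> complex" where \<sigma>: "inj \<sigma>" "range \<sigma> \<subseteq> ?E"
    by auto
  have \<sigma>_ge: "\<delta> \<le> cmod (\<sigma> n)" for n
    using \<sigma>(2) by auto
  have "\<exists>x. x \<noteq> 0 \<and> A x = \<sigma> n *\<^sub>C x" for n
    using \<sigma>(2) by auto
  then obtain x where x: "\<And>n. x n \<noteq> 0" "\<And>n. A (x n) = \<sigma> n *\<^sub>C x n"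
    by metis
  \<comment> \<open>\<open>M n\<close> is the kernel of \<open>(\<sigma>\<^sub>0 - A) \<dots> (\<sigma>\<^sub>n\<^sub>-\<^sub>1 - A)\<close>; unlike a span of eigenvectors it is trivially closed.\<close>
  define M where "M = rec_nat {0} (\<lambda>n S. {y. \<sigma> n *\<^sub>C y - A y \<in> S})"
  have M_0: "M 0 = {0}" and M_Suc: "M (Suc n) = {y. \<sigma> n *\<^sub>C y - A y \<in> M n}" for n
    by (simp_all add: M_def)
  have M_sub: "cvec.subspace (M n)" for n
  proof (induction n)
    case 0
    then show ?case
      by (simp add: M_0)
  next
    case (Suc n)
    show ?case
      unfolding cvec.subspace_def
    proof (intro conjI allI ballI)
      show "0 \<in> M (Suc n)"
        by (simp add: M_Suc cvec.subspace_0[OF Suc])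
    next
      fix u v assume "u \<in> M (Suc n)" "v \<in> M (Suc n)"
      then have "(\<sigma> n *\<^sub>C u - A u) + (\<sigma> n *\<^sub>C v - A v) \<in> M n"
        by (intro cvec.subspace_add Suc) (simp_all add: M_Suc)
      then show "u + v \<in> M (Suc n)"
        by (simp add: M_Suc blinfun.add_right scaleC_add_right algebra_simps)
    next
      fix c u assume "u \<in> M (Suc n)"
      then have "c *\<^sub>C (\<sigma> n *\<^sub>C u - A u) \<in> M n"
        by (intro cvec.subspace_scale Suc) (simp_all add: M_Suc)
      then show "c *\<^sub>C u \<in> M (Suc n)"
        by (simp add: M_Suc A_scale cvec.scale_right_diff_distrib scaleC_scaleC mult.commute)
    qed
  qed
  have M_closed: "closed (M n)" for n
  proof (induction n)
    case (Suc n)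
    have "closed ((\<lambda>y. \<sigma> n *\<^sub>C y - A y) -` M n)"
      using Suc by (intro closed_vimage continuous_intros)
    then show ?case
      by (simp add: M_Suc vimage_def)
  qed (simp add: M_0)
  have A_M: "A y \<in> M n" if "y \<in> M n" for y n
    using that
  proof (induction n arbitrary: y)
    case (Suc n)
    then have "A (\<sigma> n *\<^sub>C y - A y) \<in> M n"
      by (simp add: M_Suc)
    then show ?case
      by (simp add: M_Suc blinfun.diff_right A_scale)
  qed (simp add: M_0)
  have M_Suc_mono: "M n \<subseteq> M (Suc n)" for n
  proof
    fix y assume "y \<in> M n"
    then have "\<sigma> n *\<^sub>C y - A y \<in> M n"
      by (intro cvec.subspace_diff cvec.subspace_scale M_sub A_M)
    then show "y \<in> M (Suc n)"
      by (simp add: M_Suc)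
  qed
  have M_mono: "M m \<subseteq> M n" if "m \<le> n" for m n
    by (rule lift_Suc_mono_le[of M, OF M_Suc_mono that])
  \<comment> \<open>On \<open>x n\<close> the factor \<open>\<sigma> k - A\<close> is multiplication
    by \<open>\<sigma> k - \<sigma> n\<close>, which is non-zero for \<open>k < n\<close>, so none
    of these factors annihilates it.\<close>
  have x_notin: "x n \<notin> M k" if "k \<le> n" for n k
    using that
  proof (induction k)
    case (Suc k)
    then have "\<sigma> k - \<sigma> n \<noteq> 0"
      using \<sigma>(1) by (auto dest: injD)
    show ?case
    proof
      assume "x n \<in> M (Suc k)"
      then have "(\<sigma> k - \<sigma> n) *\<^sub>C x n \<in> M k"
        by (simp add: M_Suc x cvec.scale_left_diff_distrib)
      then have "(1 / (\<sigma> k - \<sigma> n)) *\<^sub>C (\<sigma> k - \<sigma> n) *\<^sub>C x n \<in> M k"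
        by (rule cvec.subspace_scale[OF M_sub])
      moreover have "1 / (\<sigma> k - \<sigma> n) * (\<sigma> k - \<sigma> n) = 1"
        using \<open>\<sigma> k - \<sigma> n \<noteq> 0\<close> by (rule nonzero_eq_divide_eq[THEN iffD1]) simp
      ultimately have "x n \<in> M k"
        by (metis scaleC_scaleC scaleC_one)
      with Suc show False
        by simp
    qed
  qed (simp add: M_0 x)
  have "x n \<in> M (Suc n)" for n
    by (simp add: M_Suc x cvec.subspace_0[OF M_sub])
  then have M_Suc_strict: "M n \<subset> M (Suc n)" for n
    using x_notin[of n n] M_Suc_mono[of n] by blast
  have "\<exists>e. e \<in> M (Suc n) \<and> norm e = 1 \<and> (\<forall>y\<in>M n. cinner y e = 0)" for n
    using unit_vector_orthogonal[OF M_sub M_closed M_sub M_Suc_strict] by metis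
  then obtain e where e: "\<And>n. e n \<in> M (Suc n)" "\<And>n. norm (e n) = 1"
      "\<And>n y. y \<in> M n \<Longrightarrow> cinner y (e n) = 0"
    by metis
  have "\<delta> \<le> norm (A (e m) - A (e n))" if "m < n" for m n
  proof -
    \<comment> \<open>\<open>A e_m - A e_n\<close> is
      \<open>A e_m + (\<sigma> n e_n - A e_n)\<close> minus \<open>\<sigma> n e_n\<close>; the first
      part lies in \<open>M n\<close>, the second is orthogonal to it.\<close>
    have "A (e m) \<in> M n"
      using A_M[OF e(1)[of m]] M_mono[of "Suc m" n] that by auto
    moreover have "\<sigma> n *\<^sub>C e n - A (e n) \<in> M n"
      using e(1)[of n] by (simp add: M_Suc)
    ultimately have "(A (e m) + (\<sigma> n *\<^sub>C e n - A (e n))) \<in> M n"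
      by (intro cvec.subspace_add M_sub)
    then have "- (A (e m) + (\<sigma> n *\<^sub>C e n - A (e n))) \<in> M n"
      by (intro cvec.subspace_neg M_sub)
    then have "norm (\<sigma> n *\<^sub>C e n) \<le> norm (\<sigma> n *\<^sub>C e n + - (A (e m) + (\<sigma> n *\<^sub>C e n - A (e n))))"
      by (intro norm_le_norm_add_orthogonal) (simp add: cinner_scaleC_right e(3))
    then show ?thesis
      using \<sigma>_ge[of n] by (simp add: norm_scaleC e(2) norm_minus_commute)
  qed
  then show False
    by (rule compact_operator_not_separated[OF A e(2) \<open>\<delta> > 0\<close>])
qed

lemma compact_operator_isolated_spectrum:
  fixes A :: "'a :: chilbert_space \<Rightarrow>\<^sub>L 'a"
  assumes A: "compact_operator A" and "\<mu> \<noteq> 0"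
  shows "\<exists>\<epsilon>>0. \<forall>\<sigma>\<in>ball \<mu> \<epsilon> - {\<mu>}. op_invertible (cscale \<sigma> - A)"
proof -
  \<comment> \<open>Eigenvalues may accumulate at 0, so the neighbourhood of \<mu> is kept at
    distance \<delta> from it.\<close>
  define \<delta> where "\<delta> = cmod \<mu> / 2"
  have "\<delta> > 0"
    using assms by (simp add: \<delta>_def)
  obtain d where d: "d > 0"
      "\<And>\<sigma>. \<delta> \<le> cmod \<sigma> \<Longrightarrow> (\<exists>x. x \<noteq> 0 \<and> A x = \<sigma> *\<^sub>C x) \<Longrightarrow> \<sigma> \<noteq> \<mu> \<Longrightarrow> d \<le> dist \<mu> \<sigma>"
    using finite_set_avoid[OF compact_operator_finite_eigenvalues[OF A \<open>\<delta> > 0\<close>], of \<mu>] by auto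
  show ?thesis
  proof (intro exI[of _ "min d \<delta>"] conjI ballI)
    fix \<sigma> assume \<sigma>: "\<sigma> \<in> ball \<mu> (min d \<delta>) - {\<mu>}"
    have "cmod \<mu> - cmod \<sigma> \<le> dist \<mu> \<sigma>"
      unfolding dist_norm by (rule norm_triangle_ineq2)
    with \<sigma> have "\<delta> \<le> cmod \<sigma>"
      by (auto simp: \<delta>_def field_simps)
    moreover from this have "\<sigma> \<noteq> 0"
      using \<open>\<delta> > 0\<close> by auto
    ultimately show "op_invertible (cscale \<sigma> - A)"
      using d(2)[of \<sigma>] \<sigma> by (intro compact_operator_shift_invertible A) auto
  qed (use d \<open>\<delta> > 0\<close> in auto)
qed

section \<open>Riesz idempotents\<close>

lemma exp_tendsto_0_at_top:
  assumes "\<delta> > (0 :: real)"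
  shows "((\<lambda>t. exp (- (t * \<delta>))) \<longlongrightarrow> 0) at_top"
proof -
  have "filterlim (\<lambda>t. t * \<delta>) at_top at_top"
    by (rule filterlim_at_top_mult_tendsto_pos[OF tendsto_const assms filterlim_ident])
  then have "filterlim (\<lambda>t. - (t * \<delta>)) at_bot at_top"
    by (simp add: filterlim_uminus_at_bot)
  from filterlim_compose[OF exp_at_bot this] show ?thesis .
qed

text \<open>Conjugation reflects the circle and reverses its orientation; the resulting sign cancels
  against that of the conjugate of \<open>2 pi i\<close> in \<open>residue_cnj\<close>.\<close>

lemma cnj_circlepath: "cnj \<circ> circlepath (cnj \<mu>) \<rho> = reversepath (circlepath \<mu> \<rho>)"
proof
  fix t
  have "exp (2 * complex_of_real pi * \<i> * of_real (1 - t)) = exp (- (2 * complex_of_real pi * \<i> * of_real t))"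
    by (simp add: algebra_simps exp_diff exp_minus divide_inverse)
  then show "(cnj \<circ> circlepath (cnj \<mu>) \<rho>) t = reversepath (circlepath \<mu> \<rho>) t"
    by (simp add: circlepath reversepath_def exp_cnj)
qed

lemma has_contour_integral_residue:
  assumes "f holomorphic_on ball \<mu> \<epsilon> - {\<mu>}" "0 < \<rho>" "\<rho> < \<epsilon>"
  shows "(f has_contour_integral 2 * of_real pi * \<i> * residue f \<mu>) (circlepath \<mu> \<rho>)"
  using base_residue[of "ball \<mu> \<epsilon>" \<mu> \<rho> f] assms by (auto simp: cball_subset_ball_iff)

lemma residue_cnj:
  assumes "\<epsilon> > 0" and f: "f holomorphic_on ball \<mu> \<epsilon> - {\<mu>}"
    and g: "g holomorphic_on ball (cnj \<mu>) \<epsilon> - {cnj \<mu>}"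
    and fg: "\<And>\<sigma>. \<sigma> \<in> ball \<mu> \<epsilon> - {\<mu>} \<Longrightarrow> g (cnj \<sigma>) = cnj (f \<sigma>)"
  shows "residue g (cnj \<mu>) = cnj (residue f \<mu>)"
proof -
  define \<rho> where "\<rho> = \<epsilon> / 2"
  have \<rho>: "0 < \<rho>" "\<rho> < \<epsilon>"
    using assms by (simp_all add: \<rho>_def)
  have "(f has_contour_integral 2 * of_real pi * \<i> * residue f \<mu>) (circlepath \<mu> \<rho>)"
    by (rule has_contour_integral_residue[OF f \<rho>])
  then have F: "contour_integral (reversepath (circlepath \<mu> \<rho>)) f = - (2 * of_real pi * \<i> * residue f \<mu>)"
    by (intro contour_integral_unique has_contour_integral_reversepath) auto
  have G: "(g has_contour_integral 2 * of_real pi * \<i> * residue g (cnj \<mu>)) (circlepath (cnj \<mu>) \<rho>)"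
    by (rule has_contour_integral_residue[OF g \<rho>])
  have "((cnj \<circ> f \<circ> cnj) has_contour_integral 2 * of_real pi * \<i> * residue g (cnj \<mu>)) (circlepath (cnj \<mu>) \<rho>)"
  proof (rule has_contour_integral_eq[OF G])
    fix \<sigma> assume "\<sigma> \<in> path_image (circlepath (cnj \<mu>) \<rho>)"
    then have "cmod (cnj \<mu> - \<sigma>) = \<rho>"
      using \<rho> by (simp add: dist_norm)
    then have "cmod (\<mu> - cnj \<sigma>) = \<rho>"
      using complex_mod_cnj[of "cnj \<mu> - \<sigma>"] by simp
    then have "cnj \<sigma> \<in> ball \<mu> \<epsilon> - {\<mu>}"
      using \<rho> by (auto simp: dist_norm)
    from fg[OF this] show "g \<sigma> = (cnj \<circ> f \<circ> cnj) \<sigma>"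
      by simp
  qed
  then have "contour_integral (circlepath (cnj \<mu>) \<rho>) (cnj \<circ> f \<circ> cnj) = 2 * of_real pi * \<i> * residue g (cnj \<mu>)"
    by (rule contour_integral_unique)
  with contour_integral_cnj[OF valid_path_circlepath, of "cnj \<mu>" \<rho> f] F
  show ?thesis
    by (simp add: cnj_circlepath)
qed

lemma continuous_on_cscale [continuous_intros]:
  assumes "continuous_on S f"
  shows "continuous_on S (\<lambda>t. cscale (f t) :: 'a :: chilbert_space \<Rightarrow>\<^sub>L 'a)"
proof -
  have "bounded_linear (cscale :: complex \<Rightarrow> 'a \<Rightarrow>\<^sub>L 'a)"
  proof (rule bounded_linear_intro[where K = 1])
    show "cscale (c + d) = cscale c + (cscale d :: 'a \<Rightarrow>\<^sub>L 'a)" for c d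
      by (rule blinfun_eqI) (simp add: blinfun.add_left scaleC_add_left)
    show "cscale (r *\<^sub>R c) = r *\<^sub>R (cscale c :: 'a \<Rightarrow>\<^sub>L 'a)" for r c
      by (rule blinfun_eqI) (simp add: blinfun.scaleR_left scaleR_scaleC scaleC_scaleC scaleR_conv_of_real)
  qed (simp add: norm_cscale_le)
  from bounded_linear.continuous_on[OF this assms] show ?thesis .
qed

text \<open>The radius \<epsilon> is a parameter, so that an operator and its adjoint can be treated
  over discs of the same size.\<close>

locale isolated_spectral_value =
  fixes A :: "'a :: chilbert_space \<Rightarrow>\<^sub>L 'a" and \<mu> :: complex and \<epsilon> :: real
  assumes clinear: "clinear_op A"
    and \<epsilon>_pos: "\<epsilon> > 0"
    and invertible: "\<sigma> \<in> ball \<mu> \<epsilon> - {\<mu>} \<Longrightarrow> op_invertible (cscale \<sigma> - A)"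
begin

abbreviation U :: "complex set" where "U \<equiv> ball \<mu> \<epsilon> - {\<mu>}"

definition R :: "complex \<Rightarrow> 'a \<Rightarrow>\<^sub>L 'a" where
  "R \<sigma> = opinverse (cscale \<sigma> - A)"

lemma R_right: "\<sigma> \<in> U \<Longrightarrow> A (R \<sigma> x) = \<sigma> *\<^sub>C R \<sigma> x - x"
  using opinverse_right[OF invertible, of \<sigma> x] by (simp add: R_def blinfun.diff_left algebra_simps)

lemma R_left: "\<sigma> \<in> U \<Longrightarrow> R \<sigma> (\<sigma> *\<^sub>C x - A x) = x"
  using opinverse_left[OF invertible, of \<sigma> x] by (simp add: R_def blinfun.diff_left)

text \<open>Elements of the operator type are only real-linear, so complex linearity of the
  resolvent has to be inherited from \<open>A\<close>.\<close>

lemma R_scaleC: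
  assumes "\<sigma> \<in> U"
  shows "R \<sigma> (c *\<^sub>C x) = c *\<^sub>C R \<sigma> x"
proof -
  have "\<sigma> *\<^sub>C c *\<^sub>C R \<sigma> x - A (c *\<^sub>C R \<sigma> x) = c *\<^sub>C x"
    by (simp add: clinear_opD[OF clinear] R_right[OF assms] cvec.scale_right_diff_distrib
        scaleC_scaleC mult.commute)
  with R_left[OF assms, of "c *\<^sub>C R \<sigma> x"] show ?thesis
    by simp
qed

lemma resolvent_identity:
  assumes "\<sigma> \<in> U" "\<tau> \<in> U"
  shows "R \<sigma> x - R \<tau> x = (\<tau> - \<sigma>) *\<^sub>C R \<sigma> (R \<tau> x)"
proof -
  have "x = (\<sigma> *\<^sub>C R \<tau> x - A (R \<tau> x)) + (\<tau> - \<sigma>) *\<^sub>C R \<tau> x"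
    by (simp add: R_right[OF assms(2)] cvec.scale_left_diff_distrib)
  then have "R \<sigma> x = R \<sigma> (\<sigma> *\<^sub>C R \<tau> x - A (R \<tau> x)) + R \<sigma> ((\<tau> - \<sigma>) *\<^sub>C R \<tau> x)"
    by (metis blinfun.add_right)
  then show ?thesis
    by (simp add: R_left[OF assms(1)] R_scaleC[OF assms(1)])
qed

lemma norm_R_diff_le:
  assumes "\<sigma> \<in> U" "\<tau> \<in> U"
  shows "norm (R \<tau> - R \<sigma>) \<le> cmod (\<tau> - \<sigma>) * norm (R \<sigma>) * norm (R \<tau>)"
proof (rule norm_blinfun_bound)
  fix x
  have "norm ((R \<tau> - R \<sigma>) x) = cmod (\<tau> - \<sigma>) * norm (R \<sigma> (R \<tau> x))"
    by (metis resolvent_identity[OF assms] blinfun.diff_left norm_minus_commute norm_scaleC)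
  also have "\<dots> \<le> cmod (\<tau> - \<sigma>) * (norm (R \<sigma>) * (norm (R \<tau>) * norm x))"
    by (intro mult_left_mono order_trans[OF norm_blinfun]) (simp_all add: norm_blinfun mult_left_mono)
  finally show "norm ((R \<tau> - R \<sigma>) x) \<le> cmod (\<tau> - \<sigma>) * norm (R \<sigma>) * norm (R \<tau>) * norm x"
    by (simp add: mult_ac)
qed (simp add: zero_le_mult_iff)

lemma continuous_on_R: "continuous_on U R"
  unfolding continuous_on_def
proof
  fix \<sigma> assume \<sigma>: "\<sigma> \<in> U"
  define b where "b = norm (R \<sigma>) + 1"
  have "b > 0"
    by (simp add: b_def add_nonneg_pos)
  \<comment> \<open>The resolvent identity bounds the difference by a term containing
    \<open>norm (R \<tau>)\<close> itself. Within \<open>1 / (2 * b)\<close> of \<sigma> that term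
    is absorbed into the left-hand side, which leaves
    \<open>norm (R \<tau>) \<le> 2 * b\<close>.\<close>
  have bound: "norm (R \<tau> - R \<sigma>) \<le> cmod (\<tau> - \<sigma>) * (2 * b * b)"
    if \<tau>: "\<tau> \<in> U" and d: "cmod (\<tau> - \<sigma>) < 1 / (2 * b)" for \<tau>
  proof -
    have "norm (R \<tau>) \<le> norm (R \<sigma>) + norm (R \<tau> - R \<sigma>)"
      using norm_triangle_sub[of "R \<tau>" "R \<sigma>"] .
    also have "\<dots> \<le> b + cmod (\<tau> - \<sigma>) * b * norm (R \<tau>)"
      by (intro add_mono order_trans[OF norm_R_diff_le[OF \<sigma> \<tau>]] mult_mono) (simp_all add: b_def)
    also have "\<dots> \<le> b + 1 / 2 * norm (R \<tau>)"
      using d \<open>b > 0\<close> by (intro add_mono mult_right_mono) (auto simp: field_simps)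
    finally have "norm (R \<tau>) \<le> 2 * b"
      by simp
    then have "cmod (\<tau> - \<sigma>) * norm (R \<sigma>) * norm (R \<tau>) \<le> cmod (\<tau> - \<sigma>) * b * (2 * b)"
      using \<open>b > 0\<close> by (intro mult_mono) (simp_all add: b_def)
    with norm_R_diff_le[OF \<sigma> \<tau>] show ?thesis
      by (simp add: mult_ac)
  qed
  have "((\<lambda>\<tau>. R \<tau> - R \<sigma>) \<longlongrightarrow> 0) (at \<sigma> within U)"
  proof (rule Lim_null_comparison)
    have "\<forall>\<^sub>F \<tau> in at \<sigma> within U. dist \<tau> \<sigma> < 1 / (2 * b) \<and> \<tau> \<in> U"
      using \<open>b > 0\<close> by (auto simp: eventually_at intro!: exI[of _ "1 / (2 * b)"])
    then show "\<forall>\<^sub>F \<tau> in at \<sigma> within U. norm (R \<tau> - R \<sigma>) \<le> cmod (\<tau> - \<sigma>) * (2 * b * b)"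
      by eventually_elim (simp add: bound dist_norm)
    have "((\<lambda>\<tau>. cmod (\<tau> - \<sigma>) * (2 * b * b)) \<longlongrightarrow> cmod (\<sigma> - \<sigma>) * (2 * b * b)) (at \<sigma> within U)"
      by (intro tendsto_intros)
    then show "((\<lambda>\<tau>. cmod (\<tau> - \<sigma>) * (2 * b * b)) \<longlongrightarrow> 0) (at \<sigma> within U)"
      by simp
  qed
  then show "(R \<longlongrightarrow> R \<sigma>) (at \<sigma> within U)"
    by (rule Lim_null[THEN iffD2])
qed

text \<open>By the resolvent identity the difference quotient is
  \<open>- cinner y (R \<sigma> (R \<tau> x))\<close>, and continuity of \<open>R\<close> gives the
  limit. Scalar holomorphy suffices, since matrix elements determine an operator.\<close>

lemma holomorphic_cinner_R: "(\<lambda>\<sigma>. cinner y (R \<sigma> x)) holomorphic_on U"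
proof (rule holomorphic_onI)
  fix \<sigma> assume \<sigma>: "\<sigma> \<in> U"
  have "((\<lambda>\<tau>. (cinner y (R \<tau> x) - cinner y (R \<sigma> x)) / (\<tau> - \<sigma>)) \<longlongrightarrow> - cinner y (R \<sigma> (R \<sigma> x)))
      (at \<sigma> within U)"
  proof (rule Lim_transform_eventually)
    have "(R \<longlongrightarrow> R \<sigma>) (at \<sigma> within U)"
      using continuous_on_R \<sigma> unfolding continuous_on_def by blast
    then show "((\<lambda>\<tau>. - cinner y (R \<sigma> (R \<tau> x))) \<longlongrightarrow> - cinner y (R \<sigma> (R \<sigma> x))) (at \<sigma> within U)"
      by (intro tendsto_intros)
    have "\<forall>\<^sub>F \<tau> in at \<sigma> within U. \<tau> \<noteq> \<sigma> \<and> \<tau> \<in> U"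
      by (auto simp: eventually_at intro!: exI[of _ 1])
    then show "\<forall>\<^sub>F \<tau> in at \<sigma> within U.
        - cinner y (R \<sigma> (R \<tau> x)) = (cinner y (R \<tau> x) - cinner y (R \<sigma> x)) / (\<tau> - \<sigma>)"
    proof eventually_elim
      case (elim \<tau>)
      then have "cinner y (R \<sigma> x) - cinner y (R \<tau> x) = (\<tau> - \<sigma>) * cinner y (R \<sigma> (R \<tau> x))"
        using arg_cong[OF resolvent_identity[OF \<sigma>, of \<tau> x], of "cinner y"]
        by (simp add: cinner_diff_right cinner_scaleC_right)
      then have "cinner y (R \<tau> x) - cinner y (R \<sigma> x) = (\<tau> - \<sigma>) * - cinner y (R \<sigma> (R \<tau> x))"
        by (metis minus_diff_eq mult_minus_right)
      with elim show ?case
        by simp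
    qed
  qed
  then have "((\<lambda>\<sigma>. cinner y (R \<sigma> x)) has_field_derivative - cinner y (R \<sigma> (R \<sigma> x))) (at \<sigma> within U)"
    by (simp add: has_field_derivative_iff)
  then show "(\<lambda>\<sigma>. cinner y (R \<sigma> x)) field_differentiable at \<sigma> within U"
    by (auto simp: field_differentiable_def)
qed

lemma circlepath_in_U: "0 < \<rho> \<Longrightarrow> \<rho> < \<epsilon> \<Longrightarrow> circlepath \<mu> \<rho> t \<in> U"
  by (simp add: circlepath dist_norm norm_mult)

lemma continuous_on_R_circlepath:
  assumes "0 < \<rho>" "\<rho> < \<epsilon>"
  shows "continuous_on S (\<lambda>t. R (circlepath \<mu> \<rho> t))"
proof (rule continuous_on_compose2[OF continuous_on_R])
  show "continuous_on S (circlepath \<mu> \<rho>)"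
    unfolding circlepath by (intro continuous_intros)
qed (rule image_subsetI, rule circlepath_in_U[OF assms])

text \<open>The weight is the derivative of \<open>circlepath \<mu> \<rho>\<close> written out,
  which makes the integrand visibly continuous.\<close>

definition circle_integral :: "real \<Rightarrow> 'a \<Rightarrow>\<^sub>L 'a" where
  "circle_integral \<rho> = integral {0..1}
     (\<lambda>t. cscale (2 * of_real pi * \<i> * of_real \<rho> * exp (2 * of_real pi * \<i> * of_real t)) o\<^sub>L R (circlepath \<mu> \<rho> t))"

lemma has_integral_circle_integral:
  assumes "0 < \<rho>" "\<rho> < \<epsilon>"
  shows "((\<lambda>t. cscale (2 * of_real pi * \<i> * of_real \<rho> * exp (2 * of_real pi * \<i> * of_real t)) o\<^sub>L R (circlepath \<mu> \<rho> t))
    has_integral circle_integral \<rho>) {0..1}"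
  unfolding circle_integral_def
  by (intro integrable_integral integrable_continuous_interval continuous_intros
      continuous_on_R_circlepath assms bounded_bilinear.continuous_on[OF bounded_bilinear_blinfun_compose])

lemma has_op_contour_integral_circle_integral:
  assumes "0 < \<rho>" "\<rho> < \<epsilon>"
  shows "has_op_contour_integral R (circle_integral \<rho>) (circlepath \<mu> \<rho>)"
  unfolding has_op_contour_integral_def
  using has_integral_circle_integral[OF assms]
  by (rule has_integral_eq[rotated]) (simp add: vector_derivative_circlepath01)

lemma has_integral_circle_integral_apply:
  assumes "0 < \<rho>" "\<rho> < \<epsilon>"
  shows "((\<lambda>t. (2 * of_real pi * \<i> * of_real \<rho> * exp (2 * of_real pi * \<i> * of_real t)) *\<^sub>C R (circlepath \<mu> \<rho> t) x)
    has_integral circle_integral \<rho> x) {0..1}"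
  using has_integral_linear[OF has_integral_circle_integral[OF assms]
      bounded_bilinear.bounded_linear_left[OF bounded_bilinear_blinfun_apply, of x]]
  by (simp add: o_def)

text \<open>The right-hand side does not mention \<rho>: this is where independence of the radius
  comes from.\<close>

lemma cinner_circle_integral:
  assumes "0 < \<rho>" "\<rho> < \<epsilon>"
  shows "cinner y (circle_integral \<rho> x) = 2 * of_real pi * \<i> * residue (\<lambda>\<sigma>. cinner y (R \<sigma> x)) \<mu>"
proof -
  have "((\<lambda>t. cinner y ((2 * of_real pi * \<i> * of_real \<rho> * exp (2 * of_real pi * \<i> * of_real t)) *\<^sub>C R (circlepath \<mu> \<rho> t) x))
    has_integral cinner y (circle_integral \<rho> x)) {0..1}"
    using has_integral_linear[OF has_integral_circle_integral_apply[OF assms]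
      bounded_bilinear.bounded_linear_right[OF bounded_bilinear_cinner, of y]]
    by (simp add: o_def)
  then have "((\<lambda>\<sigma>. cinner y (R \<sigma> x)) has_contour_integral cinner y (circle_integral \<rho> x)) (circlepath \<mu> \<rho>)"
    by (simp add: has_contour_integral vector_derivative_circlepath cinner_scaleC_right mult_ac)
  moreover have "((\<lambda>\<sigma>. cinner y (R \<sigma> x)) has_contour_integral
      2 * of_real pi * \<i> * residue (\<lambda>\<sigma>. cinner y (R \<sigma> x)) \<mu>) (circlepath \<mu> \<rho>)"
    by (rule has_contour_integral_residue[OF holomorphic_cinner_R assms])
  ultimately show ?thesis
    by (rule has_contour_integral_unique)
qed

lemma circle_integral_eq:
  assumes "0 < \<rho>" "\<rho> < \<epsilon>" "0 < \<rho>'" "\<rho>' < \<epsilon>"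
  shows "circle_integral \<rho> = circle_integral \<rho>'"
  by (intro blinfun_eqI cinner_left_cancel) (simp add: cinner_circle_integral assms)

text \<open>\<open>riesz_idempotent\<close> asks for agreement at all sufficiently small radii. All
  radii below \<epsilon> give the same integral, so a value exists; a competing value can be tested
  at a single small radius, so it is unique.\<close>

lemma riesz_idempotent_eq:
  assumes \<rho>: "0 < \<rho>" "\<rho> < \<epsilon>"
  shows "riesz_idempotent A \<mu> = cscale (1 / (2 * of_real pi * \<i>)) o\<^sub>L circle_integral \<rho>"
  unfolding riesz_idempotent_def R_def[symmetric, abs_def] of_real_mult of_real_numeral
proof (rule the_equality)
  have "\<forall>\<^sub>F \<rho>' in at_right 0. \<rho>' \<in> {0<..<\<epsilon>}"
    using \<epsilon>_pos by (rule eventually_at_right_real)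
  then show "\<forall>\<^sub>F \<rho>' in at_right 0. \<exists>I. has_op_contour_integral R I (circlepath \<mu> \<rho>') \<and>
      cscale (1 / (2 * of_real pi * \<i>)) o\<^sub>L circle_integral \<rho> = cscale (1 / (2 * of_real pi * \<i>)) o\<^sub>L I"
  proof eventually_elim
    case (elim \<rho>')
    then show ?case
      using circle_integral_eq[OF \<rho>, of \<rho>'] has_op_contour_integral_circle_integral[of \<rho>'] by auto
  qed
next
  fix P
  assume "\<forall>\<^sub>F \<rho>' in at_right 0. \<exists>I. has_op_contour_integral R I (circlepath \<mu> \<rho>') \<and>
      P = cscale (1 / (2 * of_real pi * \<i>)) o\<^sub>L I"
  moreover have "\<forall>\<^sub>F \<rho>' in at_right 0. \<rho>' \<in> {0<..<\<epsilon>}"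
    using \<epsilon>_pos by (rule eventually_at_right_real)
  ultimately have "\<exists>\<rho>'. (\<exists>I. has_op_contour_integral R I (circlepath \<mu> \<rho>') \<and>
      P = cscale (1 / (2 * of_real pi * \<i>)) o\<^sub>L I) \<and> \<rho>' \<in> {0<..<\<epsilon>}"
    by (intro eventually_happens'[OF trivial_limit_at_right_real] eventually_conj)
  then obtain \<rho>' I where \<rho>': "0 < \<rho>'" "\<rho>' < \<epsilon>"
      and I: "has_op_contour_integral R I (circlepath \<mu> \<rho>')" "P = cscale (1 / (2 * of_real pi * \<i>)) o\<^sub>L I"
    by auto
  have "I = circle_integral \<rho>'"
    using I(1) has_op_contour_integral_circle_integral[OF \<rho>']
    unfolding has_op_contour_integral_def by (rule has_integral_unique)
  with I(2) circle_integral_eq[OF \<rho> \<rho>'] show "P = cscale (1 / (2 * of_real pi * \<i>)) o\<^sub>L circle_integral \<rho>"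
    by simp
qed

lemma cinner_riesz_idempotent:
  "cinner y (riesz_idempotent A \<mu> x) = residue (\<lambda>\<sigma>. cinner y (R \<sigma> x)) \<mu>"
proof -
  have \<rho>: "0 < \<epsilon> / 2" "\<epsilon> / 2 < \<epsilon>"
    using \<epsilon>_pos by simp_all
  show ?thesis
    by (simp add: riesz_idempotent_eq[OF \<rho>] cinner_scaleC_right cinner_circle_integral[OF \<rho>])
qed

text \<open>
  The orbit \<open>exp (i t A) P x\<close> is represented by inserting \<open>exp (i t \<sigma>)\<close> into the contour integral
  of \<open>P x\<close>.
\<close>

lemma riesz_idempotent_orbit:
  assumes "Im \<mu> > 0"
  obtains w where "w 0 = riesz_idempotent A \<mu> x"
    "\<And>t. (w has_vector_derivative \<i> *\<^sub>C A (w t)) (at t)" "(w \<longlongrightarrow> 0) at_top"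
proof -
  \<comment> \<open>The bound \<epsilon> keeps the circle where the resolvent exists, the bound
    \<open>Im \<mu>\<close> keeps it in the upper half-plane; halving makes both strict.\<close>
  define \<rho> where "\<rho> = min \<epsilon> (Im \<mu>) / 2"
  have \<rho>: "0 < \<rho>" "\<rho> < \<epsilon>" "\<rho> < Im \<mu>"
    using assms \<epsilon>_pos by (auto simp: \<rho>_def)
  define e where "e \<tau> = exp (2 * of_real pi * \<i> * of_real \<tau>)" for \<tau> :: real
  define \<gamma> where "\<gamma> \<tau> = \<mu> + \<rho> * e \<tau>" for \<tau>
  have circle: "circlepath \<mu> \<rho> = \<gamma>"
    by (auto simp: circlepath \<gamma>_def e_def)
  have cmod_e: "cmod (e \<tau>) = 1" for \<tau>
    by (simp add: e_def)
  have \<gamma>_U: "\<gamma> \<tau> \<in> U" for \<tau>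
    using circlepath_in_U[OF \<rho>(1,2)] by (simp add: circle)
  have cont_e: "continuous_on S e" for S
    unfolding e_def by (intro continuous_intros)
  have cont_\<gamma>: "continuous_on S \<gamma>" for S
    unfolding \<gamma>_def by (intro continuous_intros cont_e)
  have cont_R: "continuous_on S (\<lambda>\<tau>. R (\<gamma> \<tau>))" for S
    using continuous_on_R_circlepath[OF \<rho>(1,2)] by (simp add: circle)
  \<comment> \<open>The derivative of the circle is \<open>2 pi i \<rho> e\<close>; its factor
    \<open>2 pi i\<close> has been cancelled against the normalization of the idempotent.\<close>
  define k where "k t \<tau> = exp (\<i> * of_real t * \<gamma> \<tau>) * (\<rho> * e \<tau>)" for t \<tau> :: real
  define w where "w t = integral {0..1} (\<lambda>\<tau>. k t \<tau> *\<^sub>C R (\<gamma> \<tau>) x)" for t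
  have cont_k: "continuous_on S (k t)" for S t
    unfolding k_def by (intro continuous_intros cont_e cont_\<gamma>)
  have cont_integrand: "continuous_on S (\<lambda>\<tau>. k t \<tau> *\<^sub>C R (\<gamma> \<tau>) x)" for S t
    by (intro continuous_intros cont_k cont_R)
  have integrand: "((\<lambda>\<tau>. k t \<tau> *\<^sub>C R (\<gamma> \<tau>) x) has_integral w t) {0..1}" for t
    unfolding w_def by (intro integrable_integral integrable_continuous_interval cont_integrand)
  \<comment> \<open>Cauchy's theorem for the entire function \<open>exp (i t \<sigma>)\<close>. It
    removes the term \<open>- x\<close> in
    \<open>A (R \<sigma> x) = \<sigma> R \<sigma> x - x\<close> when \<open>A\<close> is applied to
    the orbit.\<close>
  have k_integral: "(k t has_integral 0) {0..1}" for t
  proof -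
    have "((\<lambda>\<sigma>. exp (\<i> * of_real t * \<sigma>)) has_contour_integral 0) (circlepath \<mu> \<rho>)"
      by (rule Cauchy_theorem_disc_simple[where a = \<mu> and e = "\<rho> + 1"])
         (use \<rho> in \<open>auto intro!: holomorphic_intros\<close>)
    then have "((\<lambda>\<tau>. exp (\<i> * of_real t * \<gamma> \<tau>) * (2 * of_real pi * \<i> * \<rho> * e \<tau>)) has_integral 0) {0..1}"
      unfolding has_contour_integral vector_derivative_circlepath by (simp add: circle e_def)
    from has_integral_mult_right[OF this, of "1 / (2 * of_real pi * \<i>)"]
    have "((\<lambda>\<tau>. 1 / (2 * of_real pi * \<i>) *
        (exp (\<i> * of_real t * \<gamma> \<tau>) * (2 * of_real pi * \<i> * \<rho> * e \<tau>))) has_integral 0) {0..1}"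
      by simp
    then show ?thesis
      by (rule has_integral_eq[rotated]) (simp add: k_def mult.left_commute[of _ \<i>])
  qed
  show ?thesis
  proof
    have "circle_integral \<rho> x = (2 * of_real pi * \<i>) *\<^sub>C w 0"
      using has_integral_linear[OF integrand[of 0] bounded_linear_scaleC[of "2 * of_real pi * \<i>"]]
        has_integral_circle_integral_apply[OF \<rho>(1,2), of x]
      by (intro has_integral_unique) (auto simp: o_def k_def circle e_def scaleC_scaleC mult_ac)
    then show "w 0 = riesz_idempotent A \<mu> x"
      by (simp add: riesz_idempotent_eq[OF \<rho>(1,2)] scaleC_scaleC scaleC_one)
  next
    fix t
    have deriv: "(w has_vector_derivative integral (cbox 0 1) (\<lambda>\<tau>. (\<i> * \<gamma> \<tau> * k t \<tau>) *\<^sub>C R (\<gamma> \<tau>) x)) (at t)"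
      unfolding w_def[abs_def] box_real[symmetric]
    proof (rule leibniz_rule_vector_derivative[where U = UNIV])
      fix t \<tau> :: real
      have "((\<lambda>z. exp (\<i> * z * \<gamma> \<tau>) * (\<rho> * e \<tau>)) has_field_derivative \<i> * \<gamma> \<tau> * k t \<tau>) (at (of_real t))"
        by (auto intro!: derivative_eq_intros simp: k_def)
      then have "((\<lambda>t. k t \<tau>) has_vector_derivative \<i> * \<gamma> \<tau> * k t \<tau>) (at t)"
        unfolding k_def by (rule has_vector_derivative_real_field)
      from bounded_linear.has_vector_derivative[OF bounded_bilinear.bounded_linear_left[OF bounded_bilinear_scaleC] this]
      show "((\<lambda>t. k t \<tau> *\<^sub>C R (\<gamma> \<tau>) x) has_vector_derivative (\<i> * \<gamma> \<tau> * k t \<tau>) *\<^sub>C R (\<gamma> \<tau>) x) (at t)" .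
    next
      fix t :: real
      show "(\<lambda>\<tau>. k t \<tau> *\<^sub>C R (\<gamma> \<tau>) x) integrable_on cbox 0 1"
        using integrand[of t] by (auto simp: integrable_on_def)
    next
      have c2: "continuous_on (UNIV \<times> cbox 0 1) (\<lambda>p :: real \<times> real. h (snd p))"
        if "continuous_on UNIV h" for h :: "real \<Rightarrow> 'b :: topological_space"
        by (rule continuous_on_compose2[OF that continuous_on_snd]) (auto intro: continuous_intros)
      show "continuous_on (UNIV \<times> cbox 0 1) (\<lambda>(t, \<tau>). (\<i> * \<gamma> \<tau> * k t \<tau>) *\<^sub>C R (\<gamma> \<tau>) x)"
        unfolding k_def split_beta by (intro continuous_intros c2 cont_e cont_\<gamma> cont_R)
    qed simp_all
    have "((\<lambda>\<tau>. \<i> *\<^sub>C A (k t \<tau> *\<^sub>C R (\<gamma> \<tau>) x)) has_integral \<i> *\<^sub>C A (w t)) {0..1}"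
      using has_integral_linear[OF has_integral_linear[OF integrand blinfun.bounded_linear_right] bounded_linear_scaleC]
      by (simp add: o_def)
    moreover have "((\<lambda>\<tau>. (\<i> * k t \<tau>) *\<^sub>C x) has_integral (\<i> * 0) *\<^sub>C x) {0..1}"
      using has_integral_linear[OF has_integral_mult_right[OF k_integral]
        bounded_bilinear.bounded_linear_left[OF bounded_bilinear_scaleC]] by (simp add: o_def)
    ultimately have "((\<lambda>\<tau>. \<i> *\<^sub>C A (k t \<tau> *\<^sub>C R (\<gamma> \<tau>) x) + (\<i> * k t \<tau>) *\<^sub>C x) has_integral
        \<i> *\<^sub>C A (w t) + (\<i> * 0) *\<^sub>C x) {0..1}"
      by (rule has_integral_add)
    moreover have "\<i> *\<^sub>C A (k t \<tau> *\<^sub>C R (\<gamma> \<tau>) x) + (\<i> * k t \<tau>) *\<^sub>C x = (\<i> * \<gamma> \<tau> * k t \<tau>) *\<^sub>C R (\<gamma> \<tau>) x" for \<tau>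
      by (simp add: clinear_opD[OF clinear] R_right[OF \<gamma>_U] cvec.scale_right_diff_distrib scaleC_scaleC mult_ac)
    ultimately have "integral {0..1} (\<lambda>\<tau>. (\<i> * \<gamma> \<tau> * k t \<tau>) *\<^sub>C R (\<gamma> \<tau>) x) = \<i> *\<^sub>C A (w t)"
      by (simp add: integral_unique)
    with deriv show "(w has_vector_derivative \<i> *\<^sub>C A (w t)) (at t)"
      by simp
  next
    have "bounded ((\<lambda>\<tau>. R (\<gamma> \<tau>) x) ` {0..1})"
      by (intro compact_imp_bounded compact_continuous_image continuous_intros cont_R) simp
    then obtain C where C: "\<And>\<tau>. \<tau> \<in> {0..1} \<Longrightarrow> norm (R (\<gamma> \<tau>) x) \<le> C"
      unfolding bounded_iff by blast
    \<comment> \<open>The imaginary part of the lowest point of the circle, so that for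
      \<open>t \<ge> 0\<close> the modulus of \<open>exp (i t \<sigma>)\<close> on the circle is at
      most \<open>exp (- t \<delta>)\<close>.\<close>
    define \<delta> where "\<delta> = Im \<mu> - \<rho>"
    have "\<delta> > 0"
      using \<rho> by (simp add: \<delta>_def)
    have bound: "norm (w t) \<le> exp (- (t * \<delta>)) * (\<rho> * C)" if "t \<ge> 0" for t
    proof -
      have "norm (w t) \<le> (exp (- (t * \<delta>)) * (\<rho> * C)) * (1 - 0)"
        unfolding w_def
      proof (rule integral_bound)
        fix \<tau> :: real assume \<tau>: "\<tau> \<in> {0..1}"
        have "\<bar>Im (\<rho> * e \<tau>)\<bar> \<le> \<rho>"
          using abs_Im_le_cmod[of "\<rho> * e \<tau>"] \<rho>(1) by (simp add: norm_mult cmod_e)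
        then have "\<delta> \<le> Im (\<gamma> \<tau>)"
          by (simp add: \<delta>_def \<gamma>_def)
        then have "cmod (k t \<tau>) \<le> exp (- (t * \<delta>)) * \<rho>"
          using \<rho>(1) that by (simp add: k_def norm_mult cmod_e mult_left_mono)
        then show "norm (k t \<tau> *\<^sub>C R (\<gamma> \<tau>) x) \<le> exp (- (t * \<delta>)) * (\<rho> * C)"
          unfolding norm_scaleC mult.assoc[symmetric] using C[OF \<tau>] \<rho>(1) by (intro mult_mono) auto
      qed (simp_all add: cont_integrand)
      then show ?thesis
        by simp
    qed
    have "((\<lambda>t. exp (- (t * \<delta>)) * (\<rho> * C)) \<longlongrightarrow> 0) at_top"
      using tendsto_mult_left_zero[OF exp_tendsto_0_at_top[OF \<open>\<delta> > 0\<close>]] .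
    moreover have "\<forall>\<^sub>F t in at_top. norm (w t) \<le> exp (- (t * \<delta>)) * (\<rho> * C)"
      using eventually_ge_at_top[of 0] by eventually_elim (rule bound)
    ultimately show "(w \<longlongrightarrow> 0) at_top"
      by (rule Lim_null_comparison[rotated])
  qed
qed

end

text \<open>The resolvent of \<open>B\<close> at the conjugate of \<sigma> is adjoint to that of
  \<open>A\<close> at \<sigma>; taking residues of the matrix elements preserves this
  relation.\<close>

lemma riesz_idempotent_adjoint:
  assumes "isolated_spectral_value A \<mu> \<epsilon>" "isolated_spectral_value B (cnj \<mu>) \<epsilon>"
    and adj: "\<And>x y. cinner x (A y) = cinner (B x) y"
  shows "cinner x (riesz_idempotent A \<mu> y) = cinner (riesz_idempotent B (cnj \<mu>) x) y"
proof -
  interpret A: isolated_spectral_value A \<mu> \<epsilon>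
    by fact
  interpret B: isolated_spectral_value B "cnj \<mu>" \<epsilon>
    by fact
  have "residue (\<lambda>\<sigma>. cinner y (B.R \<sigma> x)) (cnj \<mu>) = cnj (residue (\<lambda>\<sigma>. cinner x (A.R \<sigma> y)) \<mu>)"
  proof (rule residue_cnj[OF A.\<epsilon>_pos A.holomorphic_cinner_R B.holomorphic_cinner_R])
    fix \<sigma> assume \<sigma>: "\<sigma> \<in> ball \<mu> \<epsilon> - {\<mu>}"
    have "dist (cnj \<mu>) (cnj \<sigma>) = dist \<mu> \<sigma>"
      by (metis complex_cnj_diff complex_mod_cnj dist_norm)
    with \<sigma> have \<sigma>': "cnj \<sigma> \<in> ball (cnj \<mu>) \<epsilon> - {cnj \<mu>}"
      by auto
    have "cinner x (A.R \<sigma> y) = cinner (cnj \<sigma> *\<^sub>C B.R (cnj \<sigma>) x - B (B.R (cnj \<sigma>) x)) (A.R \<sigma> y)"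
      by (simp add: B.R_right[OF \<sigma>'])
    also have "\<dots> = cinner (B.R (cnj \<sigma>) x) (\<sigma> *\<^sub>C A.R \<sigma> y - A (A.R \<sigma> y))"
      by (simp add: cinner_diff_left cinner_diff_right cinner_scaleC_left cinner_scaleC_right adj)
    also have "\<dots> = cinner (B.R (cnj \<sigma>) x) y"
      by (simp add: A.R_right[OF \<sigma>])
    finally show "cinner y (B.R (cnj \<sigma>) x) = cnj (cinner x (A.R \<sigma> y))"
      using cinner_commute by metis
  qed
  then show ?thesis
    by (metis A.cinner_riesz_idempotent B.cinner_riesz_idempotent cinner_commute complex_cnj_cnj)
qed

section \<open>The sandwiched resolvent\<close>

lemma cvec_subspace_is_operator: "is_operator T \<Longrightarrow> cvec.subspace T"
  by (auto simp: is_operator_def cvec.subspace_def scaleC_prod_def zero_prod_def)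

lemma op_adjointI: "(\<And>x v. (x, v) \<in> T \<Longrightarrow> cinner y v = cinner w x) \<Longrightarrow> (y, w) \<in> op_adjoint T"
  by (auto simp: op_adjoint_def)

lemma op_adjointD: "(y, w) \<in> op_adjoint T \<Longrightarrow> (x, v) \<in> T \<Longrightarrow> cinner y v = cinner w x"
  by (auto simp: op_adjoint_def)

lemma cvec_subspace_op_adjoint: "cvec.subspace (op_adjoint T)"
  unfolding cvec.subspace_def
  by (auto intro!: op_adjointI simp: op_adjointD cinner_simps scaleC_prod_def zero_prod_def)

text \<open>For a self-adjoint operator, which equals its adjoint, this is closedness of the
  graph.\<close>

lemma closed_op_adjoint: "closed (op_adjoint T)"
proof -
  have "op_adjoint T = (\<Inter>q\<in>T. {p. cinner (fst p) (snd q) = cinner (snd p) (fst q)})"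
    unfolding op_adjoint_def by fastforce
  then show ?thesis
    by (auto intro!: closed_INT closed_Collect_eq continuous_intros)
qed

lemma cvec_subspace_closure:
  assumes "cvec.subspace M"
  shows "cvec.subspace (closure M)"
  unfolding cvec.subspace_def
proof (intro conjI allI ballI)
  show "0 \<in> closure M"
    using cvec.subspace_0[OF assms] closure_subset by blast
next
  fix x y assume "x \<in> closure M" "y \<in> closure M"
  then obtain f g where f: "\<And>n. f n \<in> M" "f \<longlonglongrightarrow> x" and g: "\<And>n. g n \<in> M" "g \<longlonglongrightarrow> y"
    unfolding closure_sequential by blast
  have "f n + g n \<in> M" for n
    by (intro cvec.subspace_add assms f g)
  with tendsto_add[OF f(2) g(2)] show "x + y \<in> closure M"
    unfolding closure_sequential by (intro exI[of _ "\<lambda>n. f n + g n"]) simp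
next
  fix c x assume "x \<in> closure M"
  then obtain f where f: "\<And>n. f n \<in> M" "f \<longlonglongrightarrow> x"
    unfolding closure_sequential by blast
  have "c *\<^sub>C f n \<in> M" for n
    by (intro cvec.subspace_scale assms f)
  moreover have "(\<lambda>n. c *\<^sub>C f n) \<longlonglongrightarrow> c *\<^sub>C x"
    by (intro tendsto_intros f)
  ultimately show "c *\<^sub>C x \<in> closure M"
    unfolding closure_sequential by (intro exI[of _ "\<lambda>n. c *\<^sub>C f n"]) simp
qed

text \<open>
  Von Neumann's argument: a vector \<open>y\<close> orthogonal to the domain of the adjoint is examined by
  decomposing \<open>(0, y)\<close> along the graph of the operator.
\<close>

lemma densely_defined_op_adjoint:
  assumes F: "is_operator F" "closed F"
  shows "closure (Domain (op_adjoint F)) = UNIV"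
proof (rule subspace_eq_UNIV)
  have "cvec.subspace (Domain (op_adjoint F))"
    unfolding cvec.subspace_def
  proof (intro conjI allI ballI)
    show "0 \<in> Domain (op_adjoint F)"
      using cvec.subspace_0[OF cvec_subspace_op_adjoint[of F]] by (auto simp: zero_prod_def)
  next
    fix x y assume "x \<in> Domain (op_adjoint F)" "y \<in> Domain (op_adjoint F)"
    then obtain u v where "(x, u) \<in> op_adjoint F" "(y, v) \<in> op_adjoint F"
      by auto
    from cvec.subspace_add[OF cvec_subspace_op_adjoint this] show "x + y \<in> Domain (op_adjoint F)"
      by auto
  next
    fix c x assume "x \<in> Domain (op_adjoint F)"
    then obtain u where "(x, u) \<in> op_adjoint F"
      by auto
    from cvec.subspace_scale[OF cvec_subspace_op_adjoint this, of c] show "c *\<^sub>C x \<in> Domain (op_adjoint F)"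
      by (auto simp: scaleC_prod_def)
  qed
  then show "cvec.subspace (closure (Domain (op_adjoint F)))"
    by (rule cvec_subspace_closure)
next
  fix y assume orth: "\<And>x. x \<in> closure (Domain (op_adjoint F)) \<Longrightarrow> cinner x y = 0"
  obtain p where p: "p \<in> F" "\<And>q. q \<in> F \<Longrightarrow> cinner q ((0, y) - p) = 0"
    using orthogonal_projection_exists[OF cvec_subspace_is_operator[OF F(1)] F(2)] by metis
  obtain a b where ab: "p = (a, b)"
    by (cases p)
  have eq: "cinner v (y - b) = cinner x a" if "(x, v) \<in> F" for x v
    using p(2)[OF that] by (simp add: cinner_prod_def ab cinner_minus_right)
  \<comment> \<open>So \<open>y - b\<close> is orthogonal to \<open>y\<close>, and \<open>eq\<close>
    at \<open>(a, b)\<close> gives \<open>cinner (y - b) b = cinner a a\<close>. Together these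
    force \<open>y = b\<close> and \<open>a = 0\<close>, which puts \<open>(0, y)\<close> into the
    graph of \<open>F\<close>.\<close>
  have "(y - b, a) \<in> op_adjoint F"
    by (rule op_adjointI) (metis eq cinner_commute)
  then have "cinner (y - b) y = 0"
    by (intro orth closure_subset[THEN subsetD]) auto
  moreover have "cinner (y - b) b = cinner a a"
    using eq[of a b] p(1) by (metis ab cinner_commute)
  ultimately have "cinner (y - b) (y - b) + cinner a a = 0"
    by (simp add: cinner_diff_right)
  then have "complex_of_real ((norm (y - b))\<^sup>2 + (norm a)\<^sup>2) = 0"
    by (simp add: cinner_self)
  then have "(norm (y - b))\<^sup>2 + (norm a)\<^sup>2 = 0"
    using of_real_eq_0_iff by blast
  then have "a = 0" "y = b"
    by (simp_all add: sum_power2_eq_zero_iff)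
  with p(1) ab have "(0, y) \<in> F"
    by simp
  with F(1) show "y = 0"
    unfolding is_operator_def single_valued_def by blast
qed simp

section \<open>Self-adjoint operators: lower bound and surjectivity at non-real points\<close>

lemma self_adjoint_symmetric:
  assumes "self_adjoint S" "(x, u) \<in> S" "(y, v) \<in> S"
  shows "cinner x v = cinner u y"
  using assms op_adjointD[of x u S y v] by (simp add: self_adjoint_def)

text \<open>\<open>cinner x u\<close> is real by symmetry, so the imaginary part of
  \<open>cinner x (u - z x)\<close> comes from \<open>z\<close> alone; Cauchy-Schwarz does the
  rest.\<close>

lemma self_adjoint_bounded_below:
  assumes "self_adjoint S" "(x, u) \<in> S"
  shows "\<bar>Im z\<bar> * norm x \<le> norm (u - z *\<^sub>C x)"
proof (cases "x = 0")
  case False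
  have "cinner x u = cnj (cinner x u)"
    using self_adjoint_symmetric[OF assms assms(2)] cinner_commute by metis
  then have "Im (cinner x u) = 0"
    by (simp add: complex_eq_iff)
  then have "Im (cinner x (u - z *\<^sub>C x)) = - (Im z * (norm x)\<^sup>2)"
    by (simp add: cinner_diff_right cinner_scaleC_right cinner_self del: of_real_power)
  then have "\<bar>Im z\<bar> * (norm x)\<^sup>2 \<le> cmod (cinner x (u - z *\<^sub>C x))"
    using abs_Im_le_cmod[of "cinner x (u - z *\<^sub>C x)"] by (simp add: abs_mult)
  also have "\<dots> \<le> norm x * norm (u - z *\<^sub>C x)"
    by (rule cinner_Cauchy_Schwarz)
  finally show ?thesis
    using False by (simp add: power2_eq_square mult.left_commute[of _ "norm x"])
qed simp

text \<open>The shift is bounded below in the graph norm, so its range is closed. A non-zero vector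
  orthogonal to the range would be an eigenvector of \<open>S\<close> for the conjugate of
  \<open>z\<close>, which the lower bound excludes.\<close>

lemma self_adjoint_shift_surj:
  fixes S :: "('a :: chilbert_space \<times> 'a) set"
  assumes S: "self_adjoint S" and z: "Im z \<noteq> 0"
  shows "\<exists>h u. (h, u) \<in> S \<and> u - z *\<^sub>C h = y"
proof -
  define f where "f p = snd p - z *\<^sub>C fst p" for p :: "'a \<times> 'a"
  have f: "bounded_linear f"
    unfolding f_def
    by (intro bounded_linear_sub bounded_linear_snd
        bounded_linear_compose[OF bounded_linear_scaleC bounded_linear_fst])
  have "cvec.subspace S"
    using S by (auto simp: self_adjoint_def intro: cvec_subspace_is_operator)
  note subS = \<open>cvec.subspace S\<close>
  \<comment> \<open>With \<open>norm u \<le> norm (f p) + cmod z * norm x\<close> the graph norm is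
    at most \<open>norm (f p) + (1 + cmod z) * norm x\<close>; the fraction accounts for the
    multiple of \<open>norm x\<close>, the summand 1 for \<open>norm (f p)\<close>.\<close>
  define C where "C = (1 + cmod z) / \<bar>Im z\<bar> + 1"
  have "C > 0"
    by (simp add: C_def add_nonneg_pos)
  have bound: "(1 / C) * norm p \<le> norm (f p)" if "p \<in> S" for p
  proof -
    obtain x u where p: "p = (x, u)"
      by (cases p)
    have x: "norm x \<le> norm (f p) / \<bar>Im z\<bar>"
      using self_adjoint_bounded_below[OF S, of x u z] that z by (simp add: p f_def field_simps)
    have "norm u \<le> norm (f p) + cmod z * norm x"
      using norm_triangle_ineq[of "f p" "z *\<^sub>C x"] by (simp add: p f_def norm_scaleC)
    then have "norm p \<le> norm (f p) + (1 + cmod z) * norm x"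
      using norm_Pair_le[of x u] by (simp add: p algebra_simps)
    also have "\<dots> \<le> norm (f p) + (1 + cmod z) * (norm (f p) / \<bar>Im z\<bar>)"
      by (intro add_left_mono mult_left_mono x) simp
    also have "\<dots> = C * norm (f p)"
      by (simp add: C_def algebra_simps)
    finally show ?thesis
      using \<open>C > 0\<close> by (simp add: field_simps)
  qed
  have "closed S"
    using S closed_op_adjoint[of S] by (simp add: self_adjoint_def)
  then have "complete (f ` S)"
    using \<open>C > 0\<close> bound
    by (intro complete_isometric_image[of "1 / C"] real_subspace_if_complex subS f)
       (auto simp: complete_eq_closed)
  then have closed: "closed (f ` S)"
    by (simp add: complete_eq_closed)
  have f_simps: "f (p + q) = f p + f q" "f (c *\<^sub>C p) = c *\<^sub>C f p" "f 0 = 0" for p q c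
    by (simp_all add: f_def scaleC_prod_def scaleC_add_right cvec.scale_right_diff_distrib
        scaleC_scaleC mult.commute)
  have "cvec.subspace (f ` S)"
    unfolding cvec.subspace_def
  proof (intro conjI allI ballI)
    show "0 \<in> f ` S"
      using cvec.subspace_0[OF subS] f_simps(3) by (metis imageI)
  next
    fix x y assume "x \<in> f ` S" "y \<in> f ` S"
    then show "x + y \<in> f ` S"
      using cvec.subspace_add[OF subS] by (auto simp flip: f_simps)
  next
    fix c x assume "x \<in> f ` S"
    then show "c *\<^sub>C x \<in> f ` S"
      using cvec.subspace_scale[OF subS] by (auto simp flip: f_simps)
  qed
  then have "f ` S = UNIV"
  proof (rule subspace_eq_UNIV[OF _ closed])
    fix e assume e: "\<And>y. y \<in> f ` S \<Longrightarrow> cinner y e = 0"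
    have "(e, cnj z *\<^sub>C e) \<in> op_adjoint S"
    proof (rule op_adjointI)
      fix x v assume "(x, v) \<in> S"
      then have "cinner (f (x, v)) e = 0"
        by (intro e imageI)
      then have "cinner v e = cnj z * cinner x e"
        by (simp add: f_def cinner_diff_left cinner_scaleC_left)
      then have "cnj (cinner e v) = cnj z * cnj (cinner e x)"
        using cinner_commute by metis
      then show "cinner e v = cinner (cnj z *\<^sub>C e) x"
        by (simp add: cinner_scaleC_left flip: complex_cnj_mult)
    qed
    then have "(e, cnj z *\<^sub>C e) \<in> S"
      using S by (simp add: self_adjoint_def)
    from self_adjoint_bounded_below[OF S this, of "cnj z"] z show "e = 0"
      by (simp add: mult_le_0_iff)
  qed
  then obtain p where "p \<in> S" "f p = y"
    by (metis UNIV_I imageE)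
  then show ?thesis
    by (intro exI[of _ "fst p"] exI[of _ "snd p"]) (simp add: f_def)
qed

text \<open>\<open>S\<close> is a single member of the family \<open>H\<close>: the coupling
  parameter stays fixed in the whole argument.\<close>

locale sandwiched_resolvent =
  fixes F :: "('h :: chilbert_space \<times> 'k :: chilbert_space) set" and S :: "('h \<times> 'h) set"
  assumes operator_F: "is_operator F" and closed_F: "closed F"
    and self_adjoint_S: "self_adjoint S" and Domain_S: "Domain S \<subseteq> Domain F"
    and compact_extension_exists: "Im z \<noteq> 0 \<Longrightarrow> \<exists>T. compact_extension F S z T"
begin

abbreviation T :: "complex \<Rightarrow> 'k \<Rightarrow>\<^sub>L 'k" where "T \<equiv> T_op F S"

text \<open>The graph of \<open>(S - z)\<^sup>-\<^sup>1 F\<^sup>*\<close>.\<close>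

definition W :: "complex \<Rightarrow> ('k \<times> 'h) set" where
  "W z = {(x, h). \<exists>u. (h, u) \<in> S \<and> (x, u - z *\<^sub>C h) \<in> op_adjoint F}"

lemma dense_Domain: "closure (Domain (op_adjoint F)) = UNIV"
  by (rule densely_defined_op_adjoint[OF operator_F closed_F])

lemma W_exists:
  assumes "Im z \<noteq> 0" "x \<in> Domain (op_adjoint F)"
  shows "\<exists>h. (x, h) \<in> W z"
proof -
  obtain w where w: "(x, w) \<in> op_adjoint F"
    using assms(2) by blast
  obtain h u where "(h, u) \<in> S" "u - z *\<^sub>C h = w"
    using self_adjoint_shift_surj[OF self_adjoint_S assms(1), of w] by blast
  with w show ?thesis
    by (auto simp: W_def)
qed

lemma W_diff:
  assumes "(x, h) \<in> W z" "(y, k) \<in> W z"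
  shows "(x - y, h - k) \<in> W z"
proof -
  obtain u v where u: "(h, u) \<in> S" "(x, u - z *\<^sub>C h) \<in> op_adjoint F"
    and v: "(k, v) \<in> S" "(y, v - z *\<^sub>C k) \<in> op_adjoint F"
    using assms by (auto simp: W_def)
  have "cvec.subspace S"
    using self_adjoint_S by (auto simp: self_adjoint_def intro: cvec_subspace_is_operator)
  from cvec.subspace_diff[OF this u(1) v(1)] have "(h - k, u - v) \<in> S"
    by simp
  moreover have "(x - y, (u - v) - z *\<^sub>C (h - k)) \<in> op_adjoint F"
    using cvec.subspace_diff[OF cvec_subspace_op_adjoint u(2) v(2)]
    by (simp add: cvec.scale_right_diff_distrib algebra_simps)
  ultimately show ?thesis
    by (auto simp: W_def)
qed

lemma extension_W:
  assumes "compact_extension F S z T'" "(x, h) \<in> W z"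
  shows "(h, T' x) \<in> F"
proof -
  obtain u where u: "(h, u) \<in> S" "(x, u - z *\<^sub>C h) \<in> op_adjoint F"
    using assms(2) by (auto simp: W_def)
  obtain k where k: "(h, k) \<in> F"
    using u(1) Domain_S by blast
  have "(u - z *\<^sub>C h, h) \<in> resolvent S z"
    using u(1) by (auto simp: resolvent_def)
  with u(2) k have "(x, k) \<in> op_adjoint F O resolvent S z O F"
    by blast
  with assms(1) have "k = T' x"
    by (auto simp: compact_extension_def op_graph_def)
  with k show ?thesis
    by simp
qed

text \<open>Two extensions agree on the domain of the adjoint of \<open>F\<close>, hence everywhere
  by density; so the description defining \<open>T_op\<close> denotes.\<close>

lemma compact_extension_T:
  assumes z: "Im z \<noteq> 0"
  shows "compact_extension F S z (T z)"
proof -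
  have "\<exists>!T'. compact_extension F S z T'"
  proof (rule ex_ex1I[OF compact_extension_exists[OF z]])
    fix T1 T2 assume ext: "compact_extension F S z T1" "compact_extension F S z T2"
    have "T1 x = T2 x" if x: "x \<in> Domain (op_adjoint F)" for x
    proof -
      obtain h where "(x, h) \<in> W z"
        using W_exists[OF z x] by blast
      then have "(h, T1 x) \<in> F" "(h, T2 x) \<in> F"
        by (auto intro: extension_W ext)
      with operator_F show ?thesis
        unfolding is_operator_def single_valued_def by blast
    qed
    then have "Domain (op_adjoint F) \<subseteq> {x. T1 x = T2 x}"
      by blast
    moreover have "closed {x. T1 x = T2 x}"
      by (intro closed_Collect_eq continuous_intros)
    ultimately have "closure (Domain (op_adjoint F)) \<subseteq> {x. T1 x = T2 x}"
      by (rule closure_minimal)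
    then show "T1 = T2"
      unfolding dense_Domain by (intro blinfun_eqI) auto
  qed
  from theI'[OF this] show ?thesis
    by (simp add: T_op_def)
qed

lemma compact_T: "Im z \<noteq> 0 \<Longrightarrow> compact_operator (T z)"
  using compact_extension_T by (simp add: compact_extension_def)

lemma W_T: "Im z \<noteq> 0 \<Longrightarrow> (x, h) \<in> W z \<Longrightarrow> (h, T z x) \<in> F"
  by (rule extension_W[OF compact_extension_T])

text \<open>With \<open>F h = T x\<close> the inner product becomes
  \<open>cinner ((S - z) h) h\<close>, where \<open>cinner (S h) h\<close> is real; conjugation in
  the first slot turns the sign of \<open>Im z\<close> positive.\<close>

lemma Im_cinner_T_W:
  assumes z: "Im z \<noteq> 0" and xh: "(x, h) \<in> W z"
  shows "Im (cinner x (T z x)) = Im z * (norm h)\<^sup>2"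
proof -
  obtain u where u: "(h, u) \<in> S" "(x, u - z *\<^sub>C h) \<in> op_adjoint F"
    using xh by (auto simp: W_def)
  have "cinner x (T z x) = cinner (u - z *\<^sub>C h) h"
    by (rule op_adjointD[OF u(2) W_T[OF z xh]])
  also have "\<dots> = cinner u h - cnj z * of_real ((norm h)\<^sup>2)"
    by (simp add: cinner_diff_left cinner_scaleC_left cinner_self del: of_real_power)
  also have "Im \<dots> = Im z * (norm h)\<^sup>2"
  proof -
    have "cinner u h = cnj (cinner u h)"
      using self_adjoint_symmetric[OF self_adjoint_S u(1) u(1)] cinner_commute by metis
    then show ?thesis
      by (simp add: complex_eq_iff)
  qed
  finally show ?thesis .
qed

text \<open>
  On the whole space the vector \<open>(S - z)\<^sup>-\<^sup>1 F\<^sup>* x\<close> is obtained by completion; it remains in the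
  domain of \<open>F\<close> because \<open>F\<close> is closed.
\<close>

lemma Im_cinner_T:
  assumes z: "Im z \<noteq> 0"
  shows "\<exists>h. (h, T z x) \<in> F \<and> Im (cinner x (T z x)) = Im z * (norm h)\<^sup>2"
proof -
  obtain f where f: "\<And>n. f n \<in> Domain (op_adjoint F)" "f \<longlonglongrightarrow> x"
    using dense_Domain closure_sequential by blast
  obtain h where h: "\<And>n. (f n, h n) \<in> W z"
    using W_exists[OF z f(1)] by metis
  have "\<bar>Im z\<bar> > 0"
    using z by simp
  \<comment> \<open>The identity applied to differences turns convergence of \<open>f\<close> into
    the Cauchy property of \<open>h\<close>.\<close>
  have diff: "\<bar>Im z\<bar> * (norm (h m - h n))\<^sup>2 \<le> norm (T z) * (norm (f m - f n))\<^sup>2" for m n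
  proof -
    have "\<bar>Im z\<bar> * (norm (h m - h n))\<^sup>2 = \<bar>Im (cinner (f m - f n) (T z (f m - f n)))\<bar>"
      using Im_cinner_T_W[OF z W_diff[OF h[of m] h[of n]]] by (simp add: abs_mult)
    also have "\<dots> \<le> norm (f m - f n) * norm (T z (f m - f n))"
      by (rule order_trans[OF abs_Im_le_cmod cinner_Cauchy_Schwarz])
    also have "\<dots> \<le> norm (f m - f n) * (norm (T z) * norm (f m - f n))"
      by (intro mult_left_mono norm_blinfun) simp
    finally show ?thesis
      by (simp add: power2_eq_square mult_ac)
  qed
  have "Cauchy h"
  proof (rule metric_CauchyI)
    fix e :: real assume "e > 0"
    define b where "b = norm (T z) + 1"
    have "b > 0"
      by (simp add: b_def add_nonneg_pos)
    define d where "d = e * sqrt (\<bar>Im z\<bar> / b)"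
    have "d > 0" "b * d\<^sup>2 = \<bar>Im z\<bar> * e\<^sup>2"
      using \<open>e > 0\<close> \<open>b > 0\<close> \<open>\<bar>Im z\<bar> > 0\<close> by (simp_all add: d_def power_mult_distrib)
    have "Cauchy f"
      using f(2) by (rule LIMSEQ_imp_Cauchy)
    then obtain N where N: "\<And>m n. m \<ge> N \<Longrightarrow> n \<ge> N \<Longrightarrow> norm (f m - f n) < d"
      using \<open>d > 0\<close> unfolding Cauchy_def dist_norm by meson
    have "dist (h m) (h n) < e" if "m \<ge> N" "n \<ge> N" for m n
    proof -
      have "\<bar>Im z\<bar> * (norm (h m - h n))\<^sup>2 \<le> b * (norm (f m - f n))\<^sup>2"
        by (rule order_trans[OF diff mult_right_mono]) (simp_all add: b_def)
      also have "\<dots> < b * d\<^sup>2"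
        by (intro mult_strict_left_mono power_strict_mono N that \<open>b > 0\<close>) simp_all
      finally have "(norm (h m - h n))\<^sup>2 < e\<^sup>2"
        using \<open>b * d\<^sup>2 = \<bar>Im z\<bar> * e\<^sup>2\<close> \<open>\<bar>Im z\<bar> > 0\<close> by simp
      then show ?thesis
        unfolding dist_norm by (rule power2_less_imp_less) (use \<open>e > 0\<close> in simp)
    qed
    then show "\<exists>N. \<forall>m\<ge>N. \<forall>n\<ge>N. dist (h m) (h n) < e"
      by blast
  qed
  then obtain l where l: "h \<longlonglongrightarrow> l"
    by (auto simp: Cauchy_convergent_iff convergent_def)
  have Tf: "(\<lambda>n. T z (f n)) \<longlonglongrightarrow> T z x"
    by (intro tendsto_intros f)
  have "(l, T z x) \<in> F"
    using closed_sequentially[OF closed_F W_T[OF z h] tendsto_Pair[OF l Tf]] .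
  moreover have "Im (cinner x (T z x)) = Im z * (norm l)\<^sup>2"
  proof (rule LIMSEQ_unique)
    show "(\<lambda>n. Im (cinner (f n) (T z (f n)))) \<longlonglongrightarrow> Im (cinner x (T z x))"
      by (intro tendsto_intros f Tf)
    show "(\<lambda>n. Im (cinner (f n) (T z (f n)))) \<longlonglongrightarrow> Im z * (norm l)\<^sup>2"
      unfolding Im_cinner_T_W[OF z h] by (intro tendsto_intros l)
  qed
  ultimately show ?thesis
    by blast
qed

lemma Im_cinner_T_nonneg:
  assumes "Im z \<noteq> 0"
  shows "0 \<le> Im z * Im (cinner x (T z x))"
proof -
  obtain h :: 'h where "Im (cinner x (T z x)) = Im z * (norm h)\<^sup>2"
    using Im_cinner_T[OF assms, of x] by metis
  then have "Im z * Im (cinner x (T z x)) = (Im z)\<^sup>2 * (norm h)\<^sup>2"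
    by (simp add: power2_eq_square)
  then show ?thesis
    by simp
qed

text \<open>The equality case behind strict positivity: the vector \<open>h\<close> of
  \<open>Im_cinner_T\<close> is 0, and over 0 the graph of \<open>F\<close> contains only 0.\<close>

lemma T_eq_0:
  assumes z: "Im z \<noteq> 0" and "Im (cinner x (T z x)) = 0"
  shows "T z x = 0"
proof -
  obtain h where h: "(h, T z x) \<in> F" "Im (cinner x (T z x)) = Im z * (norm h)\<^sup>2"
    using Im_cinner_T[OF z, of x] by metis
  with assms have "h = 0"
    by simp
  with h(1) operator_F show ?thesis
    unfolding is_operator_def single_valued_def by blast
qed

text \<open>On the domain of the adjoint of \<open>F\<close> the claim reduces to the symmetry of
  \<open>S\<close>; it is then extended by density in one argument at a time.\<close>

lemma T_adjoint:
  assumes z: "Im z \<noteq> 0"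
  shows "cinner x (T z y) = cinner (T (cnj z) x) y"
proof -
  have z': "Im (cnj z) \<noteq> 0"
    using z by simp
  have dom: "cinner x (T z y) = cinner (T (cnj z) x) y"
    if x: "x \<in> Domain (op_adjoint F)" and y: "y \<in> Domain (op_adjoint F)" for x y
  proof -
    obtain h k where h: "(y, h) \<in> W z" and k: "(x, k) \<in> W (cnj z)"
      using W_exists[OF z y] W_exists[OF z' x] by blast
    obtain u where u: "(h, u) \<in> S" "(y, u - z *\<^sub>C h) \<in> op_adjoint F"
      using h by (auto simp: W_def)
    obtain v where v: "(k, v) \<in> S" "(x, v - cnj z *\<^sub>C k) \<in> op_adjoint F"
      using k by (auto simp: W_def)
    have "cinner x (T z y) = cinner (v - cnj z *\<^sub>C k) h"
      by (rule op_adjointD[OF v(2) W_T[OF z h]])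
    also have "\<dots> = cinner k (u - z *\<^sub>C h)"
      using self_adjoint_symmetric[OF self_adjoint_S v(1) u(1)]
      by (simp add: cinner_diff_left cinner_diff_right cinner_scaleC_left cinner_scaleC_right)
    also have "\<dots> = cnj (cinner (u - z *\<^sub>C h) k)"
      by (rule cinner_commute)
    also have "cinner (u - z *\<^sub>C h) k = cinner y (T (cnj z) x)"
      by (rule op_adjointD[OF u(2) W_T[OF z' k], symmetric])
    also have "cnj \<dots> = cinner (T (cnj z) x) y"
      by (rule cinner_commute[symmetric])
    finally show ?thesis .
  qed
  have "closure (Domain (op_adjoint F)) \<subseteq> {y. cinner x (T z y) = cinner (T (cnj z) x) y}"
    if "x \<in> Domain (op_adjoint F)" for x
    using dom[OF that] by (intro closure_minimal closed_Collect_eq continuous_intros) auto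
  then have "Domain (op_adjoint F) \<subseteq> {x. cinner x (T z y) = cinner (T (cnj z) x) y}"
    unfolding dense_Domain by blast
  then have "closure (Domain (op_adjoint F)) \<subseteq> {x. cinner x (T z y) = cinner (T (cnj z) x) y}"
    by (rule closure_minimal) (intro closed_Collect_eq continuous_intros)
  then show ?thesis
    unfolding dense_Domain by auto
qed

end

section \<open>Positivity of the form\<close>

text \<open>
  Along an orbit of \<open>v' = i T J v\<close> the quadratic form \<open>c \<langle>v, J v\<rangle>\<close> decreases at the rate
  \<open>2 c Im \<langle>J v, T J v\<rangle>\<close>.
\<close>

lemma form_positive_on_decaying_orbit:
  fixes T J :: "'a :: chilbert_space \<Rightarrow>\<^sub>L 'a"
  assumes J: "\<And>x y. cinner x (J y) = cinner (J x) y"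
    and T: "\<And>x. 0 \<le> c * Im (cinner x (T x))" "\<And>x. c * Im (cinner x (T x)) = 0 \<Longrightarrow> T x = 0"
    and w: "\<And>t. (w has_vector_derivative \<i> *\<^sub>C T (J (w t))) (at t)" "(w \<longlongrightarrow> 0) at_top"
  shows "0 \<le> c * Re (cinner (w 0) (J (w 0)))"
    and "c * Re (cinner (w 0) (J (w 0))) = 0 \<Longrightarrow> w 0 = 0"
proof -
  define \<phi> where "\<phi> t = c * Re (cinner (w t) (J (w t)))" for t
  define \<psi> where "\<psi> t = c * Im (cinner (J (w t)) (T (J (w t))))" for t
  have deriv: "(\<phi> has_real_derivative - 2 * \<psi> t) (at t)" for t
  proof -
    define v where "v = T (J (w t))"
    have "((\<lambda>t. J (w t)) has_vector_derivative J (\<i> *\<^sub>C v)) (at t)"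
      using bounded_linear.has_vector_derivative[OF blinfun.bounded_linear_right w(1)]
      by (simp add: v_def)
    from bounded_bilinear.has_vector_derivative[OF bounded_bilinear_cinner w(1) this]
    have "((\<lambda>t. cinner (w t) (J (w t))) has_vector_derivative
        cinner (w t) (J (\<i> *\<^sub>C v)) + cinner (\<i> *\<^sub>C v) (J (w t))) (at t)"
      by (simp add: v_def)
    from bounded_linear.has_vector_derivative[OF bounded_linear_Re this]
    have "((\<lambda>t. Re (cinner (w t) (J (w t)))) has_real_derivative
        Re (cinner (w t) (J (\<i> *\<^sub>C v)) + cinner (\<i> *\<^sub>C v) (J (w t)))) (at t)"
      by (simp add: has_real_derivative_iff_has_vector_derivative)
    moreover have "Re (cinner (w t) (J (\<i> *\<^sub>C v)) + cinner (\<i> *\<^sub>C v) (J (w t)))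
        = - 2 * Im (cinner (J (w t)) v)"
      using cinner_commute[of v "J (w t)"] J[of "w t" "\<i> *\<^sub>C v"]
      by (simp add: cinner_scaleC_left cinner_scaleC_right)
    ultimately have "((\<lambda>t. Re (cinner (w t) (J (w t)))) has_real_derivative
        - 2 * Im (cinner (J (w t)) v)) (at t)"
      by simp
    from DERIV_cmult[OF this, of c] show ?thesis
      by (simp add: \<phi>_def[abs_def] \<psi>_def v_def mult_ac)
  qed
  have \<psi>: "0 \<le> \<psi> t" for t
    by (simp add: \<psi>_def T)
  have mono: "\<phi> t \<le> \<phi> s" if "s \<le> t" for s t
  proof (rule DERIV_nonpos_imp_nonincreasing[OF that])
    show "\<exists>y. (\<phi> has_real_derivative y) (at x) \<and> y \<le> 0" for x
      using deriv[of x] \<psi>[of x] by (intro exI[of _ "- 2 * \<psi> x"]) simp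
  qed
  have lim: "(\<phi> \<longlongrightarrow> 0) at_top"
  proof -
    have "(\<phi> \<longlongrightarrow> c * Re (cinner 0 (J 0))) at_top"
      unfolding \<phi>_def by (intro tendsto_intros w)
    then show ?thesis
      by simp
  qed
  have nonneg: "0 \<le> \<phi> t" for t
  proof (rule tendsto_upperbound[OF lim])
    show "\<forall>\<^sub>F s in at_top. \<phi> s \<le> \<phi> t"
      using eventually_ge_at_top[of t] by eventually_elim (rule mono)
  qed simp
  then show "0 \<le> c * Re (cinner (w 0) (J (w 0)))"
    by (simp add: \<phi>_def)
  assume "c * Re (cinner (w 0) (J (w 0))) = 0"
  then have "\<phi> 0 = 0"
    by (simp add: \<phi>_def)
  then have \<phi>_0: "\<phi> t = 0" if "t \<ge> 0" for t
    using mono[OF that] nonneg[of t] by linarith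
  \<comment> \<open>Restricted to \<open>t > 0\<close>: \<phi> is known to vanish for
    \<open>t \<ge> 0\<close>, and its two-sided derivative needs a whole neighbourhood where it
    does. The value at 0 is recovered by continuity from the right.\<close>
  have "(w has_vector_derivative 0) (at t within {0<..})" if "t > 0" for t
  proof -
    have "- 2 * \<psi> t = 0"
      by (rule DERIV_local_const[OF deriv \<open>t > 0\<close>]) (use \<phi>_0 in \<open>auto simp: abs_if split: if_splits\<close>)
    then have "T (J (w t)) = 0"
      by (intro T) (simp add: \<psi>_def)
    with w(1)[of t] show ?thesis
      by (auto intro: has_vector_derivative_at_within)
  qed
  then obtain d where d: "\<And>t. t > 0 \<Longrightarrow> w t = d"
    using has_vector_derivative_zero_constant[of "{0<..}" w] by auto
  have "(w \<longlongrightarrow> d) at_top"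
    by (rule tendsto_eventually, rule eventually_mono[OF eventually_gt_at_top[of 0] d])
  with w(2) have "d = 0"
    using tendsto_unique[of at_top] by (metis trivial_limit_at_top_linorder)
  have "(w \<longlongrightarrow> w 0) (at_right 0)"
    using has_vector_derivative_continuous[OF w(1)[of 0]]
    by (auto simp: continuous_at intro: tendsto_within_subset)
  moreover have "(w \<longlongrightarrow> d) (at_right 0)"
    by (rule tendsto_eventually, rule eventually_mono[OF eventually_at_right_less d])
  ultimately show "w 0 = 0"
    using \<open>d = 0\<close> tendsto_unique[OF trivial_limit_at_right_real] by blast
qed

text \<open>For operators that are a priori only real-linear, an adjoint with respect to the complex
  inner product forces complex linearity.\<close>

lemma clinear_op_if_adjoint:
  fixes A :: "'a :: chilbert_space \<Rightarrow>\<^sub>L 'b :: chilbert_space" and B :: "'b \<Rightarrow>\<^sub>L 'a"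
  assumes "\<And>x y. cinner x (A y) = cinner (B x) y"
  shows "clinear_op A" "clinear_op B"
proof -
  have "cinner x (A (c *\<^sub>C y)) = cinner x (c *\<^sub>C A y)" for c x y
    by (simp add: assms cinner_scaleC_right)
  then show "clinear_op A"
    unfolding clinear_op_def by (blast intro: cinner_left_cancel)
  have "cinner (B (c *\<^sub>C x)) y = cinner (c *\<^sub>C B x) y" for c x y
    by (simp add: assms[symmetric] cinner_scaleC_left)
  then show "clinear_op B"
    unfolding clinear_op_def by (blast intro: cinner_right_cancel)
qed

text \<open>\<open>M\<close> restricts to a linear isomorphism from the range of \<open>P\<close>
  onto that of the product, so spanning sets and bases carry over.\<close>

lemma oprank_comp_injective:
  fixes M P :: "'a :: chilbert_space \<Rightarrow>\<^sub>L 'a"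
  assumes M: "clinear_op M" and P: "clinear_op P"
    and inj: "\<And>x. M (P x) = 0 \<Longrightarrow> P x = 0"
  shows "oprank (M o\<^sub>L P) = oprank P"
proof -
  interpret cpair: vector_space_pair "scaleC :: complex \<Rightarrow> 'a \<Rightarrow> 'a" "scaleC :: complex \<Rightarrow> 'a \<Rightarrow> 'a" ..
  have lin: "Vector_Spaces.linear scaleC scaleC M"
    by unfold_locales (simp_all add: blinfun.add_right clinear_opD[OF M])
  define V where "V = range P"
  have sub: "cvec.subspace V"
    unfolding V_def by (rule cvec_subspace_image[OF P cvec.subspace_UNIV])
  have range: "range (M o\<^sub>L P) = M ` V"
    by (auto simp: V_def)
  have inj_M: "inj_on M V"
  proof (rule inj_onI)
    fix x y assume "x \<in> V" "y \<in> V" "M x = M y"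
    then obtain a where "x - y = P a"
      using cvec.subspace_diff[OF sub] by (auto simp: V_def)
    moreover have "M (x - y) = 0"
      using \<open>M x = M y\<close> by (simp add: blinfun.diff_right)
    ultimately show "x = y"
      using inj[of a] by simp
  qed
  \<comment> \<open>Guarantees that both ranks are computed by the same branch of
    \<open>oprank\<close>.\<close>
  have finite_iff: "(\<exists>B. finite B \<and> cvec.span B = M ` V) \<longleftrightarrow> (\<exists>B. finite B \<and> cvec.span B = V)"
  proof safe
    fix B assume B: "finite B" "cvec.span B = M ` V"
    have "B \<subseteq> M ` V"
      using cvec.span_superset[of B] B by simp
    then obtain C where C: "finite C" "C \<subseteq> V" "B = M ` C"
      using finite_subset_image[OF B(1)] by metis
    then have "M ` cvec.span C = M ` V"
      using B(2) cpair.linear_span_image[OF lin] by simp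
    moreover have "cvec.span C \<subseteq> V"
      using C(2) sub by (rule cvec.span_minimal)
    ultimately have "cvec.span C = V"
      using inj_on_image_eq_iff[OF inj_M] by blast
    with C(1) show "\<exists>B. finite B \<and> cvec.span B = V"
      by blast
  next
    fix B assume B: "finite B" "V = cvec.span B"
    then show "\<exists>C. finite C \<and> cvec.span C = M ` cvec.span B"
      by (intro exI[of _ "M ` B"]) (simp add: cpair.linear_span_image[OF lin])
  qed
  have "cvec.dim (M ` V) = cvec.dim V"
  proof -
    obtain B where B: "B \<subseteq> V" "cvec.independent B" "V \<subseteq> cvec.span B" "card B = cvec.dim V"
      using cvec.basis_exists .
    then have V: "cvec.span B = V"
      using sub cvec.span_minimal by blast
    then have "cvec.independent (M ` B)"
      using B(2) inj_M by (intro cpair.linear_independent_injective_image[OF lin]) simp_all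
    moreover have "cvec.span (M ` B) = M ` V"
      using V by (simp add: cpair.linear_span_image[OF lin])
    then have "cvec.span (M ` B) = cvec.span (M ` V)"
      by (metis cvec.span_span)
    ultimately have "cvec.dim (M ` V) = card (M ` B)"
      by (intro cvec.dim_eq_card)
    also have "\<dots> = card B"
      using inj_M B(1) by (intro card_image) (rule inj_on_subset)
    finally show ?thesis
      using B(4) by simp
  qed
  then show ?thesis
    unfolding oprank_def range V_def[symmetric] finite_iff by simp
qed

text \<open>The two radii are shrunk to a common one, as \<open>riesz_idempotent_adjoint\<close>
  requires.\<close>

lemma isolated_spectral_value_pair:
  assumes "compact_operator A" "compact_operator B" "\<mu> \<noteq> 0" "\<nu> \<noteq> 0"
  obtains \<epsilon> where "isolated_spectral_value A \<mu> \<epsilon>" "isolated_spectral_value B \<nu> \<epsilon>"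
proof -
  obtain \<epsilon>1 where 1: "\<epsilon>1 > 0" "\<forall>\<sigma>\<in>ball \<mu> \<epsilon>1 - {\<mu>}. op_invertible (cscale \<sigma> - A)"
    using compact_operator_isolated_spectrum assms by meson
  obtain \<epsilon>2 where 2: "\<epsilon>2 > 0" "\<forall>\<sigma>\<in>ball \<nu> \<epsilon>2 - {\<nu>}. op_invertible (cscale \<sigma> - B)"
    using compact_operator_isolated_spectrum assms by meson
  show ?thesis
  proof
    show "isolated_spectral_value A \<mu> (min \<epsilon>1 \<epsilon>2)"
      by unfold_locales (use 1 2 assms in \<open>auto intro: compact_operator_clinear\<close>)
    show "isolated_spectral_value B \<nu> (min \<epsilon>1 \<epsilon>2)"
      by unfold_locales (use 1 2 assms in \<open>auto intro: compact_operator_clinear\<close>)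
  qed
qed

theorem theorem1p27:
  fixes F :: "('h :: {chilbert_space, second_countable_topology} \<times>
               'k :: {chilbert_space, second_countable_topology}) set"
    and H0 V :: "('h \<times> 'h) set"
    and J :: "'k \<Rightarrow>\<^sub>L 'k"
    and H :: "real \<Rightarrow> ('h \<times> 'h) set"
    and D :: "'h set"
    and z :: complex
    and \<Gamma> :: "complex set"
    and s :: real
  assumes F: "is_operator F" "closed F" "densely_defined F"
      "op_kernel F = {0}" "op_cokernel F = {0}"
    and H0: "self_adjoint H0"
    and J: "self_adjoint (op_graph J)"
    and V: "V = F O op_graph J O op_adjoint F" "self_adjoint V"
    and H: "\<And>t. H t = pencil H0 V t"
      "\<And>t. self_adjoint (H t)" "\<And>t. Domain (H t) = D"
    and D: "closure D = UNIV" "D \<subseteq> Domain F \<inter> Domain V"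
    and V_relatively_compact: "\<And>t. relatively_compact V (H t)"
    and T_compact: "\<And>t w. Im w \<noteq> 0 \<Longrightarrow> \<exists>T. compact_extension F (H t) w T"
    and T_limit: "\<And>t. AE l in lborel.
      \<exists>L. ((\<lambda>y. T_op F (H t) (Complex l y)) \<longlongrightarrow> L) (at_right 0)"
    and z: "Im z \<noteq> 0"
    and \<Gamma>: "finite \<Gamma>" "\<And>r. r \<in> \<Gamma> \<Longrightarrow> resonance_point F J H z r \<and> Im r > 0"
  shows "nonneg_operator (Im z *\<^sub>R (Q_op F J H (cnj z) (cnj ` \<Gamma>) s o\<^sub>L J o\<^sub>L P_op F J H z \<Gamma> s)) \<and>
         oprank (Im z *\<^sub>R (Q_op F J H (cnj z) (cnj ` \<Gamma>) s o\<^sub>L J o\<^sub>L P_op F J H z \<Gamma> s)) =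
           oprank (P_op F J H z \<Gamma> s)"
proof -
  interpret sandwiched_resolvent F "H s"
    by unfold_locales (use F H D T_compact in auto)
  have J_sym: "cinner x (J y) = cinner (J x) y" for x y
    using self_adjoint_symmetric[OF J, of x "J x" y "J y"] by (auto simp: op_graph_def)
  have J_lin: "clinear_op J"
    by (rule clinear_op_if_adjoint[OF J_sym])
  define A where "A = A_op F J H z s"
  define B where "B = B_op F J H (cnj z) s"
  have z': "Im (cnj z) \<noteq> 0"
    using z by simp
  have compact: "compact_operator A" "compact_operator B"
    unfolding A_def A_op_def B_def B_op_def
    by (intro compact_operator_comp_right compact_operator_comp_left compact_T z z' J_lin)+
  have AB: "cinner x (A y) = cinner (B x) y" for x y
    by (simp add: A_def A_op_def B_def B_op_def T_adjoint[OF z] J_sym)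
  define \<mu> where "\<mu> r = 1 / (of_real s - r)" for r :: complex
  have \<mu>_Im: "Im (\<mu> r) > 0" if "r \<in> \<Gamma>" for r
  proof -
    have "Im r > 0"
      using \<Gamma>(2)[OF that] by simp
    then have "(s - Re r)\<^sup>2 + (Im r)\<^sup>2 > 0"
      by (simp add: add_nonneg_pos)
    with \<open>Im r > 0\<close> show ?thesis
      by (simp add: \<mu>_def Im_divide)
  qed
  have \<mu>_0: "\<mu> r \<noteq> 0" "cnj (\<mu> r) \<noteq> 0" if "r \<in> \<Gamma>" for r
    using \<mu>_Im[OF that] by auto
  define P where "P = P_op F J H z \<Gamma> s"
  define Q where "Q = Q_op F J H (cnj z) (cnj ` \<Gamma>) s"
  have P_eq: "P x = (\<Sum>r\<in>\<Gamma>. riesz_idempotent A (\<mu> r) x)" for x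
    by (simp add: P_def P_op_def A_def \<mu>_def blinfun.sum_left)
  \<comment> \<open>Since \<open>s\<close> is real, \<open>1 / (s - cnj r)\<close> is the conjugate
    of \<open>\<mu> r\<close>; injectivity of conjugation lets the sum run over \<Gamma>.\<close>
  have Q_eq: "Q x = (\<Sum>r\<in>\<Gamma>. riesz_idempotent B (cnj (\<mu> r)) x)" for x
  proof -
    have "inj_on cnj \<Gamma>"
      by (auto intro: inj_onI)
    then show ?thesis
      by (simp add: Q_def Q_op_def B_def \<mu>_def blinfun.sum_left sum.reindex)
  qed
  have PQ: "cinner x (P y) = cinner (Q x) y" for x y
  proof -
    have "cinner x (riesz_idempotent A (\<mu> r) y) = cinner (riesz_idempotent B (cnj (\<mu> r)) x) y"
      if "r \<in> \<Gamma>" for r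
      using isolated_spectral_value_pair[OF compact \<mu>_0[OF that]] riesz_idempotent_adjoint[OF _ _ AB]
      by metis
    then show ?thesis
      by (simp add: P_eq Q_eq bounded_bilinear.sum_left[OF bounded_bilinear_cinner]
          bounded_bilinear.sum_right[OF bounded_bilinear_cinner])
  qed
  have positive: "0 \<le> Im z * Re (cinner (P x) (J (P x)))"
    "Im z * Re (cinner (P x) (J (P x))) = 0 \<Longrightarrow> P x = 0" for x
  proof -
    have "\<exists>w. w 0 = riesz_idempotent A (\<mu> r) x \<and>
        (\<forall>t. (w has_vector_derivative \<i> *\<^sub>C A (w t)) (at t)) \<and> (w \<longlongrightarrow> 0) at_top" if r: "r \<in> \<Gamma>" for r
    proof -
      obtain \<epsilon> where "isolated_spectral_value A (\<mu> r) \<epsilon>"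
        using isolated_spectral_value_pair[OF compact \<mu>_0[OF r]] by metis
      from isolated_spectral_value.riesz_idempotent_orbit[OF this \<mu>_Im[OF r], of x] show ?thesis
        by metis
    qed
    then obtain w where w: "\<And>r. r \<in> \<Gamma> \<Longrightarrow> w r 0 = riesz_idempotent A (\<mu> r) x"
      "\<And>r t. r \<in> \<Gamma> \<Longrightarrow> (w r has_vector_derivative \<i> *\<^sub>C A (w r t)) (at t)"
      "\<And>r. r \<in> \<Gamma> \<Longrightarrow> (w r \<longlongrightarrow> 0) at_top"
      by metis
    \<comment> \<open>The orbits of the individual points solve the same linear equation, so their
      sum is a decaying orbit starting at \<open>P x\<close>; evaluating the form on it includes all
      cross terms.\<close>
    define v where "v t = (\<Sum>r\<in>\<Gamma>. w r t)" for t
    have v_0: "v 0 = P x"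
      by (simp add: v_def w P_eq)
    have "(v has_vector_derivative (\<Sum>r\<in>\<Gamma>. \<i> *\<^sub>C A (w r t))) (at t)" for t
      unfolding v_def by (intro has_vector_derivative_sum w)
    then have v': "(v has_vector_derivative \<i> *\<^sub>C T z (J (v t))) (at t)" for t
      by (simp add: v_def blinfun.sum_right cvec.scale_sum_right A_def A_op_def)
    have "(v \<longlongrightarrow> (\<Sum>r\<in>\<Gamma>. 0)) at_top"
      unfolding v_def by (intro tendsto_sum w)
    then have v_lim: "(v \<longlongrightarrow> 0) at_top"
      by simp
    have "T z y = 0" if "Im z * Im (cinner y (T z y)) = 0" for y
      using that z by (intro T_eq_0) simp_all
    note form_positive_on_decaying_orbit[OF J_sym Im_cinner_T_nonneg[OF z] this v' v_lim]
    then show "0 \<le> Im z * Re (cinner (P x) (J (P x)))"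
      "Im z * Re (cinner (P x) (J (P x))) = 0 \<Longrightarrow> P x = 0"
      unfolding v_0 by simp_all
  qed
  \<comment> \<open>Splits the operator as \<open>M\<close> after \<open>P\<close>, the shape that
    \<open>oprank_comp_injective\<close> expects.\<close>
  define M where "M = Im z *\<^sub>R (Q o\<^sub>L J)"
  have N_eq: "Im z *\<^sub>R (Q o\<^sub>L J o\<^sub>L P) = M o\<^sub>L P"
    by (rule blinfun_eqI) (simp add: M_def blinfun.scaleR_left)
  \<comment> \<open>Moving \<open>Q\<close>, the adjoint of \<open>P\<close>, to the other side
    gives the form at \<open>P x\<close>; it is real because \<open>J\<close> is symmetric.\<close>
  have cinner_M: "cinner x (M (P x)) = of_real (Im z * Re (cinner (P x) (J (P x))))" for x
  proof -
    have "cinner (P x) (J (P x)) = cnj (cinner (P x) (J (P x)))"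
      using J_sym cinner_commute by metis
    then have "Im (cinner (P x) (J (P x))) = 0"
      by (simp add: complex_eq_iff)
    then have real: "cinner (P x) (J (P x)) = of_real (Re (cinner (P x) (J (P x))))"
      by (simp add: complex_eq_iff)
    have "cinner x (Q y) = cinner (P x) y" for y
      using PQ[of y x] cinner_commute by metis
    then have "cinner x (M (P x)) = of_real (Im z) * cinner (P x) (J (P x))"
      by (simp add: M_def blinfun.scaleR_left cinner_scaleR_right)
    also have "\<dots> = of_real (Im z * Re (cinner (P x) (J (P x))))"
      by (subst real) simp
    finally show ?thesis .
  qed
  have "nonneg_operator (M o\<^sub>L P)"
    unfolding nonneg_operator_def by (simp add: cinner_M positive(1) del: of_real_mult)
  moreover have "oprank (M o\<^sub>L P) = oprank P"
  proof (rule oprank_comp_injective)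
    show "clinear_op P"
      by (rule clinear_op_if_adjoint[OF PQ])
    have "clinear_op Q"
      by (rule clinear_op_if_adjoint[OF PQ])
    with J_lin show "clinear_op M"
      by (simp add: clinear_op_def M_def blinfun.scaleR_left scaleR_scaleC scaleC_scaleC mult.commute)
    \<comment> \<open>The form then vanishes at \<open>P x\<close>, and strict positivity
      applies.\<close>
    fix x assume "M (P x) = 0"
    then have "complex_of_real (Im z * Re (cinner (P x) (J (P x)))) = 0"
      by (metis cinner_M cinner_zero_right)
    then show "P x = 0"
      using positive(2) of_real_eq_0_iff by blast
  qed
  ultimately show ?thesis
    unfolding P_def[symmetric] Q_def[symmetric] N_eq by simp
qed

end
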